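(* Let $(\mathcal{E},u)$ be a pointed Arveson system. Let $A^{\mathcal{E}}_u$ be its vector space of addits, $T^{\mathcal{E}}_u$ its subspace of trivial addits and $R^{\mathcal{E}}_u$ its subspace of roots. Then the prescription $$\langle a,b\rangle := \langle a_1,b_1\rangle_{\mathcal{E}_1}\qquad (a,b\in A^{\mathcal{E}}_u)$$ endows $A^{\mathcal{E}}_u$ with the structure of a Hilbert space, for which the direct sum decomposition $$A^{\mathcal{E}}_u = T^{\mathcal{E}}_u\oplus R^{\mathcal{E}}_u$$ is an orthogonal decomposition.
   Context: Inner products are linear in the second argument. A product system $\mathcal{E}$ is a family $(\mathcal{E}_t)_{t>0}$ of Hilbert spaces with unitary structure maps $B_{s,t}:\mathcal{E}_{s+t}\to\mathcal{E}_s\otimes\mathcal{E}_t$ ($s,t>0$) satisfying $(I_{\mathcal{E}_r}\otimes B_{s,t})B_{r,s+t}=(B_{r,s}\otimes I_{\mathcal{E}_t})B_{r+s,t}$. For $x\in\mathcal{E}_s$, $y\in\mathcal{E}_t$, write $x\cdot y:=B_{s,t}^*(x\otimes y)\in\mathcal{E}_{s+t}$. An Arveson system is a product system with every $\mathcal{E}_t$ separable, equipped with a measurable structure: a countable family of sections $(e^n)_{n\ge1}$ such that $(e^n_t)_n$ is total in $\mathcal{E}_t$ for each $t$, and the functions $t\mapsto\langle e^m_t,e^n_t\rangle$ and $(s,t)\mapsto\langle e^l_{s+t},e^m_s\cdot e^n_t\rangle$ are measurable; a section $x=(x_t)_{t>0}$ is measurable if $t\mapsto\langle e^n_t,x_t\rangle$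 is measurable for all $n$. A unit is a nonzero measurable section $u$ with $u_{s+t}=u_s\cdot u_t$ ($s,t>0$); it is normalised if $\|u_t\|=1$ for all $t$. A pointed Arveson system $(\mathcal{E},u)$ is an Arveson system together with a fixed normalised unit $u$. An addit of $(\mathcal{E},u)$ is a measurable section $a$ of $\mathcal{E}$ with $a_{s+t}=a_s\cdot u_t+u_s\cdot a_t$ ($s,t>0$). A root is an addit $a$ with $\langle u_t,a_t\rangle=0$ for all $t>0$. The trivial addits are the sections $(\lambda t u_t)_{t>0}$, $\lambda\in\mathbb{C}$. Vector space operations on sections are pointwise. *)

theory Defs
  imports "HOL-Analysis.Analysis" "HOL-Algebra.Algebraic_Closure_Type"
    "HOL-Library.Poly_Mapping"
begin

section \<open>Complex Hilbert spaces\<close>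

text \<open>
  The fibres of a product system form a family of Hilbert spaces indexed by a real parameter, so
  a Hilbert space is a record with an explicit carrier. It extends the module record of
  HOL-Algebra, whose fields for a ring multiplication and a ring unit play no role here.
\<close>

abbreviation Cring :: "complex ring" where
  "Cring \<equiv> ring_of_type_algebra"

record 'a hilb = "(complex, 'a) module" +
  cinner :: "'a \<Rightarrow> 'a \<Rightarrow> complex"

definition hnorm :: "'a hilb \<Rightarrow> 'a \<Rightarrow> real" where
  "hnorm H x = sqrt (Re (cinner H x x))"

text \<open>
  The locale \<^locale>\<open>Metric_space\<close> asks for nonnegativity and symmetry on the whole type, hence the
  value \<open>0\<close> off the carrier.
\<close>

definition hdist :: "'a hilb \<Rightarrow> 'a \<Rightarrow> 'a \<Rightarrow> real" where
  "hdist H x y = (if x \<in> carrier H \<and> y \<in> carrier H then hnorm H (x \<ominus>\<^bsub>H\<^esub> y) else 0)"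

abbreviation htopology :: "'a hilb \<Rightarrow> 'a topology" where
  "htopology H \<equiv> Metric_space.mtopology (carrier H) (hdist H)"

locale inner_product_space = module Cring H for H :: "'a hilb" (structure) +
  assumes cinner_add_right:
      "\<lbrakk>x \<in> carrier H; y \<in> carrier H; z \<in> carrier H\<rbrakk> \<Longrightarrow>
        cinner H x (y \<oplus>\<^bsub>H\<^esub> z) = cinner H x y + cinner H x z"
    and cinner_smult_right:
      "\<lbrakk>x \<in> carrier H; y \<in> carrier H\<rbrakk> \<Longrightarrow> cinner H x (c \<odot>\<^bsub>H\<^esub> y) = c * cinner H x y"
    and cinner_commute:
      "\<lbrakk>x \<in> carrier H; y \<in> carrier H\<rbrakk> \<Longrightarrow> cinner H y x = cnj (cinner H x y)"
    and cinner_pos: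
      "\<lbrakk>x \<in> carrier H; x \<noteq> \<zero>\<^bsub>H\<^esub>\<rbrakk> \<Longrightarrow> Re (cinner H x x) > 0"

locale hilbert_space = inner_product_space +
  assumes complete: "Metric_space.mcomplete (carrier H) (hdist H)"

definition linear_maps :: "'a hilb \<Rightarrow> 'b hilb \<Rightarrow> ('a \<Rightarrow> 'b) set" where
  "linear_maps H K = {T \<in> carrier H \<rightarrow> carrier K.
     (\<forall>x\<in>carrier H. \<forall>y\<in>carrier H. T (x \<oplus>\<^bsub>H\<^esub> y) = T x \<oplus>\<^bsub>K\<^esub> T y) \<and>
     (\<forall>c. \<forall>x\<in>carrier H. T (c \<odot>\<^bsub>H\<^esub> x) = c \<odot>\<^bsub>K\<^esub> T x)}"

definition bounded_maps :: "'a hilb \<Rightarrow> 'b hilb \<Rightarrow> ('a \<Rightarrow> 'b) set" where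
  "bounded_maps H K =
     {T \<in> linear_maps H K. \<exists>C. \<forall>x\<in>carrier H. hnorm K (T x) \<le> C * hnorm H x}"

definition unitary_maps :: "'a hilb \<Rightarrow> 'b hilb \<Rightarrow> ('a \<Rightarrow> 'b) set" where
  "unitary_maps H K = {U \<in> linear_maps H K. bij_betw U (carrier H) (carrier K) \<and>
     (\<forall>x\<in>carrier H. \<forall>y\<in>carrier H. cinner K (U x) (U y) = cinner H x y)}"

definition hadjoint :: "'a hilb \<Rightarrow> 'b hilb \<Rightarrow> ('a \<Rightarrow> 'b) \<Rightarrow> 'b \<Rightarrow> 'a" where
  "hadjoint H K T y =
     (THE x. x \<in> carrier H \<and> (\<forall>w\<in>carrier H. cinner H x w = cinner K y (T w)))"

definition lin_span :: "'a hilb \<Rightarrow> 'a set \<Rightarrow> 'a set" where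
  "lin_span H S = (\<lambda>N. submodule N Cring H) hull S"

definition total_in :: "'a hilb \<Rightarrow> 'a set \<Rightarrow> bool" where
  "total_in H S \<longleftrightarrow> S \<subseteq> carrier H \<and> htopology H closure_of lin_span H S = carrier H"


section \<open>The Hilbert space tensor product\<close>

text \<open>
  The tensor product of \<open>H\<close> and \<open>K\<close> is the completion of the algebraic tensor product. A formal sum
  \<open>\<Sum>p. f p (fst p \<otimes> snd p)\<close> is a finitely supported function \<open>f\<close> on \<open>carrier H \<times> carrier K\<close>,
  with the positive semidefinite sesquilinear form determined by
  \<open>\<langle>x \<otimes> y, x' \<otimes> y'\<rangle> = \<langle>x, x'\<rangle> \<langle>y, y'\<rangle>\<close>. Its null vectors are precisely the formal sums that vanish
  in the algebraic tensor product. Elements of the completion are Cauchy sequences of formal sums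
  modulo sequences of seminorm tending to \<open>0\<close>, which performs both quotients at once.
\<close>

definition formal_sums :: "'a hilb \<Rightarrow> 'b hilb \<Rightarrow> ('a \<times> 'b \<Rightarrow>\<^sub>0 complex) set" where
  "formal_sums H K = {f. Poly_Mapping.keys f \<subseteq> carrier H \<times> carrier K}"

definition formal_inner ::
  "'a hilb \<Rightarrow> 'b hilb \<Rightarrow> ('a \<times> 'b \<Rightarrow>\<^sub>0 complex) \<Rightarrow> ('a \<times> 'b \<Rightarrow>\<^sub>0 complex) \<Rightarrow> complex" where
  "formal_inner H K f g =
     (\<Sum>p\<in>Poly_Mapping.keys f. \<Sum>q\<in>Poly_Mapping.keys g. cnj (Poly_Mapping.lookup f p) * Poly_Mapping.lookup g q *
        (cinner H (fst p) (fst q) * cinner K (snd p) (snd q)))"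

definition formal_cauchy :: "'a hilb \<Rightarrow> 'b hilb \<Rightarrow> (nat \<Rightarrow> 'a \<times> 'b \<Rightarrow>\<^sub>0 complex) set" where
  "formal_cauchy H K = {\<sigma>. range \<sigma> \<subseteq> formal_sums H K \<and>
     (\<forall>\<epsilon>>0. \<exists>N. \<forall>m\<ge>N. \<forall>n\<ge>N. cmod (formal_inner H K (\<sigma> m - \<sigma> n) (\<sigma> m - \<sigma> n)) < \<epsilon>)}"

definition formal_equiv ::
  "'a hilb \<Rightarrow> 'b hilb \<Rightarrow> ((nat \<Rightarrow> 'a \<times> 'b \<Rightarrow>\<^sub>0 complex) \<times> (nat \<Rightarrow> 'a \<times> 'b \<Rightarrow>\<^sub>0 complex)) set" where
  "formal_equiv H K = {(\<sigma>, \<tau>). \<sigma> \<in> formal_cauchy H K \<and> \<tau> \<in> formal_cauchy H K \<and>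
     (\<lambda>n. formal_inner H K (\<sigma> n - \<tau> n) (\<sigma> n - \<tau> n)) \<longlonglongrightarrow> 0}"

definition tensor_class ::
  "'a hilb \<Rightarrow> 'b hilb \<Rightarrow> (nat \<Rightarrow> 'a \<times> 'b \<Rightarrow>\<^sub>0 complex) \<Rightarrow> (nat \<Rightarrow> 'a \<times> 'b \<Rightarrow>\<^sub>0 complex) set" where
  "tensor_class H K \<sigma> = formal_equiv H K `` {\<sigma>}"

definition tensor_rep ::
  "(nat \<Rightarrow> 'a \<times> 'b \<Rightarrow>\<^sub>0 complex) set \<Rightarrow> nat \<Rightarrow> 'a \<times> 'b \<Rightarrow>\<^sub>0 complex" where
  "tensor_rep P = (SOME \<sigma>. \<sigma> \<in> P)"

definition hilbert_tensor ::
  "'a hilb \<Rightarrow> 'b hilb \<Rightarrow> (nat \<Rightarrow> 'a \<times> 'b \<Rightarrow>\<^sub>0 complex) set hilb" where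
  "hilbert_tensor H K =
     \<lparr> carrier = formal_cauchy H K // formal_equiv H K,
       monoid.mult = undefined,
       one = undefined,
       ring.zero = tensor_class H K (\<lambda>n. 0),
       add = (\<lambda>P Q. tensor_class H K (\<lambda>n. tensor_rep P n + tensor_rep Q n)),
       smult = (\<lambda>c P. tensor_class H K (\<lambda>n. Poly_Mapping.map ((*) c) (tensor_rep P n))),
       cinner = (\<lambda>P Q. lim (\<lambda>n. formal_inner H K (tensor_rep P n) (tensor_rep Q n))) \<rparr>"

definition pure_tensor ::
  "'a hilb \<Rightarrow> 'b hilb \<Rightarrow> 'a \<Rightarrow> 'b \<Rightarrow> (nat \<Rightarrow> 'a \<times> 'b \<Rightarrow>\<^sub>0 complex) set" where
  "pure_tensor H K x y = tensor_class H K (\<lambda>n. Poly_Mapping.single (x, y) 1)"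

text \<open>
  \<open>tensor_map H K H' K' S T\<close> is the bounded operator \<open>S \<otimes> T\<close> from \<open>H \<otimes> K\<close> to \<open>H' \<otimes> K'\<close>.
\<close>

definition tensor_map ::
  "'a hilb \<Rightarrow> 'b hilb \<Rightarrow> 'c hilb \<Rightarrow> 'd hilb \<Rightarrow> ('a \<Rightarrow> 'c) \<Rightarrow> ('b \<Rightarrow> 'd) \<Rightarrow>
    (nat \<Rightarrow> 'a \<times> 'b \<Rightarrow>\<^sub>0 complex) set \<Rightarrow> (nat \<Rightarrow> 'c \<times> 'd \<Rightarrow>\<^sub>0 complex) set" where
  "tensor_map H K H' K' S T =
     (THE F. F \<in> bounded_maps (hilbert_tensor H K) (hilbert_tensor H' K') \<and>
        F \<in> extensional (carrier (hilbert_tensor H K)) \<and>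
        (\<forall>x\<in>carrier H. \<forall>y\<in>carrier K.
           F (pure_tensor H K x y) = pure_tensor H' K' (S x) (T y)))"

text \<open>
  The canonical unitary from \<open>(H \<otimes> K) \<otimes> L\<close> to \<open>H \<otimes> (K \<otimes> L)\<close>, an identification usually left
  implicit.
\<close>

definition tensor_assoc where
  "tensor_assoc H K L =
     (THE F. F \<in> unitary_maps (hilbert_tensor (hilbert_tensor H K) L)
                              (hilbert_tensor H (hilbert_tensor K L)) \<and>
        F \<in> extensional (carrier (hilbert_tensor (hilbert_tensor H K) L)) \<and>
        (\<forall>x\<in>carrier H. \<forall>y\<in>carrier K. \<forall>z\<in>carrier L.
           F (pure_tensor (hilbert_tensor H K) L (pure_tensor H K x y) z) =
           pure_tensor H (hilbert_tensor K L) x (pure_tensor K L y z)))"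


section \<open>Product systems and Arveson systems\<close>

locale product_system =
  fixes E :: "real \<Rightarrow> 'a hilb"
    and B :: "real \<Rightarrow> real \<Rightarrow> 'a \<Rightarrow> (nat \<Rightarrow> 'a \<times> 'a \<Rightarrow>\<^sub>0 complex) set"
  assumes fibre_hilbert: "t > 0 \<Longrightarrow> hilbert_space (E t)"
    and structure_unitary:
      "\<lbrakk>s > 0; t > 0\<rbrakk> \<Longrightarrow> B s t \<in> unitary_maps (E (s + t)) (hilbert_tensor (E s) (E t))"
    and structure_coassoc:
      "\<lbrakk>r > 0; s > 0; t > 0; v \<in> carrier (E (r + s + t))\<rbrakk> \<Longrightarrow>
        tensor_map (E r) (E (s + t)) (E r) (hilbert_tensor (E s) (E t)) id (B s t)
          (B r (s + t) v) =
        tensor_assoc (E r) (E s) (E t)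
          (tensor_map (E (r + s)) (E t) (hilbert_tensor (E r) (E s)) (E t) (B r s) id
            (B (r + s) t v))"

definition sys_prod ::
  "(real \<Rightarrow> 'a hilb) \<Rightarrow> (real \<Rightarrow> real \<Rightarrow> 'a \<Rightarrow> (nat \<Rightarrow> 'a \<times> 'a \<Rightarrow>\<^sub>0 complex) set) \<Rightarrow>
    real \<Rightarrow> real \<Rightarrow> 'a \<Rightarrow> 'a \<Rightarrow> 'a" where
  "sys_prod E B s t x y =
     hadjoint (E (s + t)) (hilbert_tensor (E s) (E t)) (B s t) (pure_tensor (E s) (E t) x y)"

text \<open>
  Sections are indexed by \<open>t > 0\<close>; they are extensional, so that equality of functions is equality
  of sections.
\<close>

definition sections :: "(real \<Rightarrow> 'a hilb) \<Rightarrow> (real \<Rightarrow> 'a) set" where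
  "sections E = (\<Pi>\<^sub>E t\<in>{0<..}. carrier (E t))"

locale arveson_system = product_system +
  fixes e :: "nat \<Rightarrow> real \<Rightarrow> 'a"
  assumes fibre_separable: "t > 0 \<Longrightarrow> separable_space (htopology (E t))"
    and e_section: "e n \<in> sections E"
    and e_total: "t > 0 \<Longrightarrow> total_in (E t) (range (\<lambda>n. e n t))"
    and e_measurable_inner:
      "(\<lambda>t. cinner (E t) (e m t) (e n t)) \<in> borel_measurable (restrict_space borel {0<..})"
    and e_measurable_prod:
      "(\<lambda>(s, t). cinner (E (s + t)) (e l (s + t)) (sys_prod E B s t (e m s) (e n t)))
         \<in> borel_measurable (restrict_space borel ({0<..} \<times> {0<..}))"

definition measurable_sections ::
  "(real \<Rightarrow> 'a hilb) \<Rightarrow> (nat \<Rightarrow> real \<Rightarrow> 'a) \<Rightarrow> (real \<Rightarrow> 'a) set" where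
  "measurable_sections E e = {x \<in> sections E.
     \<forall>n. (\<lambda>t. cinner (E t) (e n t) (x t)) \<in> borel_measurable (restrict_space borel {0<..})}"

locale pointed_arveson_system = arveson_system +
  fixes u :: "real \<Rightarrow> 'a"
  assumes unit_measurable: "u \<in> measurable_sections E e"
    and unit_nonzero: "\<exists>t>0. u t \<noteq> \<zero>\<^bsub>E t\<^esub>"
    and unit_mult: "\<lbrakk>s > 0; t > 0\<rbrakk> \<Longrightarrow> u (s + t) = sys_prod E B s t (u s) (u t)"
    and unit_normalised: "t > 0 \<Longrightarrow> hnorm (E t) (u t) = 1"


section \<open>Addits\<close>

definition addits ::
  "(real \<Rightarrow> 'a hilb) \<Rightarrow> (real \<Rightarrow> real \<Rightarrow> 'a \<Rightarrow> (nat \<Rightarrow> 'a \<times> 'a \<Rightarrow>\<^sub>0 complex) set) \<Rightarrow>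
    (nat \<Rightarrow> real \<Rightarrow> 'a) \<Rightarrow> (real \<Rightarrow> 'a) \<Rightarrow> (real \<Rightarrow> 'a) set" where
  "addits E B e u = {a \<in> measurable_sections E e.
     \<forall>s>0. \<forall>t>0. a (s + t) =
       sys_prod E B s t (a s) (u t) \<oplus>\<^bsub>E (s + t)\<^esub> sys_prod E B s t (u s) (a t)}"

definition roots ::
  "(real \<Rightarrow> 'a hilb) \<Rightarrow> (real \<Rightarrow> real \<Rightarrow> 'a \<Rightarrow> (nat \<Rightarrow> 'a \<times> 'a \<Rightarrow>\<^sub>0 complex) set) \<Rightarrow>
    (nat \<Rightarrow> real \<Rightarrow> 'a) \<Rightarrow> (real \<Rightarrow> 'a) \<Rightarrow> (real \<Rightarrow> 'a) set" where
  "roots E B e u = {a \<in> addits E B e u. \<forall>t>0. cinner (E t) (u t) (a t) = 0}"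

definition trivial_addits :: "(real \<Rightarrow> 'a hilb) \<Rightarrow> (real \<Rightarrow> 'a) \<Rightarrow> (real \<Rightarrow> 'a) set" where
  "trivial_addits E u = {\<lambda>t\<in>{0<..}. (c * of_real t) \<odot>\<^bsub>E t\<^esub> u t | c. True}"

definition addit_space ::
  "(real \<Rightarrow> 'a hilb) \<Rightarrow> (real \<Rightarrow> real \<Rightarrow> 'a \<Rightarrow> (nat \<Rightarrow> 'a \<times> 'a \<Rightarrow>\<^sub>0 complex) set) \<Rightarrow>
    (nat \<Rightarrow> real \<Rightarrow> 'a) \<Rightarrow> (real \<Rightarrow> 'a) \<Rightarrow> (real \<Rightarrow> 'a) hilb" where
  "addit_space E B e u =
     \<lparr> carrier = addits E B e u,
       monoid.mult = undefined,
       one = undefined,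
       ring.zero = (\<lambda>t\<in>{0<..}. \<zero>\<^bsub>E t\<^esub>),
       add = (\<lambda>a b. \<lambda>t\<in>{0<..}. a t \<oplus>\<^bsub>E t\<^esub> b t),
       smult = (\<lambda>c a. \<lambda>t\<in>{0<..}. c \<odot>\<^bsub>E t\<^esub> a t),
       cinner = (\<lambda>a b. cinner (E 1) (a 1) (b 1)) \<rparr>"

end

theory Submission
  imports Defs
begin

text \<open>
  The products of a product system are isometric, \<open>\<langle>x \<cdot> y, x' \<cdot> y'\<rangle> = \<langle>x, x'\<rangle> \<langle>y, y'\<rangle>\<close>, and hence
  bilinear. So for an addit \<open>a\<close> the function \<open>t \<mapsto> \<langle>u\<^sub>t, a\<^sub>t\<rangle>\<close> is additive and measurable, that is,
  equal to \<open>\<lambda> t\<close> for some \<open>\<lambda>\<close>, and \<open>r\<^sub>t = a\<^sub>t - \<lambda> t u\<^sub>t\<close> is a root. For a root, \<open>t \<mapsto> \<parallel>r\<^sub>t\<parallel>\<^sup>2\<close> is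
  additive and measurable as well, so \<open>\<parallel>r\<^sub>t\<parallel>\<^sup>2 = t \<parallel>r\<^sub>1\<parallel>\<^sup>2\<close>. Altogether
  \<open>\<parallel>a\<^sub>t\<parallel>\<^sup>2 = \<bar>\<lambda>\<bar>\<^sup>2 t\<^sup>2 + t \<parallel>r\<^sub>1\<parallel>\<^sup>2 \<le> (t\<^sup>2 + t) \<parallel>a\<^sub>1\<parallel>\<^sup>2\<close>: an addit is determined by \<open>a\<^sub>1\<close>, and a sequence
  of addits that is Cauchy at time \<open>1\<close> converges at every time, to an addit.
\<close>


section \<open>Measurable additive functions\<close>

text \<open>The measurable structure controls only inner products with the sections
  \<open>e n\<close>, whereas the additive functions above are formed from \<open>u\<close> and
  \<open>a\<close>. Their measurability comes from writing a squared norm as a supremum over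
  countably many combinations of the \<open>e n\<close> with Gaussian rational coefficients,
  followed by polarisation. On the tensor side the obstacle is that the operations of
  \<open>hilbert_tensor\<close> run through arbitrarily chosen representatives. What is extracted
  from it is the inner product of two elementary tensors. Independence of the representatives rests
  on a Cauchy-Schwarz inequality for the form on formal sums, hence on the positivity of that form,
  which is the Schur product theorem for two Gram matrices. Norms and linearity of products are then
  read off from inner products.\<close>

lemma additive_of_nat_mult:
  fixes f :: "real \<Rightarrow> real"
  assumes add: "\<And>s t. \<lbrakk>s > 0; t > 0\<rbrakk> \<Longrightarrow> f (s + t) = f s + f t" and "t > 0"
  shows "f (real (Suc n) * t) = real (Suc n) * f t"
proof (induction n)
  case (Suc n)
  have "f (real (Suc (Suc n)) * t) = f (real (Suc n) * t + t)" by (simp add: algebra_simps)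
  also have "\<dots> = real (Suc n) * f t + f t"
    using Suc add[of "real (Suc n) * t" t] assms(2) by simp
  finally show ?case by (simp add: algebra_simps)
qed simp

text \<open>The defect \<open>g\<close> from linearity is additive and vanishes at some small
  \<open>r\<close> of the form 1/m, hence it has period \<open>r\<close> and is bounded on the whole
  half-line. As \<open>g\<close> at n t equals n times \<open>g t\<close>, boundedness forces
  \<open>g = 0\<close>.\<close>

lemma additive_bounded_imp_linear:
  fixes f :: "real \<Rightarrow> real"
  assumes add: "\<And>s t. \<lbrakk>s > 0; t > 0\<rbrakk> \<Longrightarrow> f (s + t) = f s + f t"
    and bdd: "d > 0" "\<And>h. \<lbrakk>0 < h; h \<le> d\<rbrakk> \<Longrightarrow> \<bar>f h\<bar> \<le> C"
    and t: "t > 0"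
  shows "f t = t * f 1"
proof -
  define n0 where "n0 = nat \<lceil>1 / d\<rceil>"
  \<comment> \<open>A reciprocal of an integer, so that additivity and \<open>g 1 = 0\<close> give
    \<open>g r = 0\<close>; \<open>n0\<close> is large enough for \<open>r \<le> d\<close>.\<close>
  define r where "r = 1 / real (Suc n0)"
  have r: "r > 0" "r \<le> d"
  proof -
    have "1 / d \<le> real (Suc n0)" unfolding n0_def by linarith
    then show "r \<le> d" using bdd(1) by (simp add: r_def field_simps)
  qed (simp add: r_def)
  define g where "g t = f t - t * f 1" for t
  have g_add: "g (s + t) = g s + g t" if "s > 0" "t > 0" for s t
    using that add by (simp add: g_def algebra_simps)
  have g_mult: "g (real (Suc n) * t) = real (Suc n) * g t" if "t > 0" for n t
    using additive_of_nat_mult[of g t n] g_add that by blast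
  have "g 1 = real (Suc n0) * g r" using g_mult[OF r(1), of n0] by (simp add: r_def)
  then have gr: "g r = 0" by (simp add: g_def)
  define M where "M = \<bar>C\<bar> + d * \<bar>f 1\<bar>"
  have small: "\<bar>g h\<bar> \<le> M" if "0 < h" "h \<le> d" for h
  proof -
    have "\<bar>g h\<bar> \<le> \<bar>f h\<bar> + h * \<bar>f 1\<bar>"
      using that abs_triangle_ineq4[of "f h" "h * f 1"] by (simp add: g_def abs_mult)
    also have "\<dots> \<le> \<bar>C\<bar> + d * \<bar>f 1\<bar>"
      using bdd(2)[OF that] that by (intro add_mono mult_right_mono) auto
    finally show ?thesis by (simp add: M_def)
  qed
  have bounded: "\<bar>g s\<bar> \<le> M" if "s > 0" for s
  proof -
    \<comment> \<open>The ceiling minus one, not the floor: the remainder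
      \<open>s - real k * r\<close> then lies in (0, r] and is never 0, where nothing is known about
      \<open>f\<close>. For the same reason \<open>k = 0\<close> is a separate case.\<close>
    define k where "k = nat (\<lceil>s / r\<rceil> - 1)"
    have c: "\<lceil>s / r\<rceil> \<ge> 1" using that r by (simp add: le_ceiling_iff)
    then have "real k = of_int \<lceil>s / r\<rceil> - 1" by (simp add: k_def)
    then have "real k < s / r" "s / r \<le> real k + 1" by linarith+
    then have k: "real k * r < s" "s \<le> real k * r + r"
      using r by (simp_all add: field_simps)
    show ?thesis
    proof (cases k)
      case 0
      then show ?thesis using k that r by (intro small) simp_all
    next
      case (Suc m)
      let ?h = "s - real k * r"
      have "g s = g (real (Suc m) * r + ?h)" using Suc by simp
      also have "\<dots> = g ?h"
        using g_add[of "real (Suc m) * r" ?h] g_mult[OF r(1), of m] gr k r Suc by simp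
      finally show ?thesis using k r small[of ?h] by simp
    qed
  qed
  have "g t = 0"
  proof (rule ccontr)
    assume "g t \<noteq> 0"
    then obtain n where "M < real n * \<bar>g t\<bar>"
      using reals_Archimedean3[of "\<bar>g t\<bar>"] by auto
    also have "\<dots> \<le> real (Suc n) * \<bar>g t\<bar>" by (intro mult_right_mono) auto
    also have "\<dots> = \<bar>g (real (Suc n) * t)\<bar>"
      by (simp only: g_mult[OF t] abs_mult abs_of_nat)
    also have "\<dots> \<le> M" using t by (intro bounded) simp
    finally show False by simp
  qed
  then show ?thesis by (simp add: g_def)
qed

text \<open>
  Some sublevel set \<open>A\<close> of \<open>\<bar>f\<bar>\<close> fills more than three quarters of \<open>(0, 1]\<close>, so it meets
  each of its small translates \<open>A - h\<close>. Hence \<open>f h = f (x + h) - f x\<close> is bounded for small \<open>h\<close>.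
\<close>

lemma additive_measurable_imp_linear:
  fixes f :: "real \<Rightarrow> real"
  assumes meas: "f \<in> borel_measurable (restrict_space borel {0<..})"
    and add: "\<And>s t. \<lbrakk>s > 0; t > 0\<rbrakk> \<Longrightarrow> f (s + t) = f s + f t"
    and t: "t > 0"
  shows "f t = t * f 1"
proof -
  define A where "A n = {x\<in>{0<..1}. \<bar>f x\<bar> \<le> real n}" for n :: nat
  have A: "A n \<in> sets lborel" for n
  proof -
    have "{x \<in> space (restrict_space borel {0<..}). \<bar>f x\<bar> \<le> real n} \<in> sets (restrict_space borel {0<..})"
      using meas by measurable
    then have "{x \<in> {0<..}. \<bar>f x\<bar> \<le> real n} \<in> sets borel"
      by (subst (asm) sets_restrict_space_iff) (auto simp: space_restrict_space)
    moreover have "A n = {x \<in> {0<..}. \<bar>f x\<bar> \<le> real n} \<inter> {..1}" by (auto simp: A_def)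
    ultimately show ?thesis by simp
  qed
  have fm: "Y \<in> fmeasurable lborel" if "Y \<in> sets lborel" "Y \<subseteq> {- 1 .. 2}" for Y :: "real set"
    by (rule fmeasurableI2[OF _ that(2)]) (use that(1) in \<open>auto intro!: fmeasurableI\<close>)
  have "(\<lambda>n. measure lborel (A n)) \<longlonglongrightarrow> measure lborel (\<Union>n. A n)"
  proof (rule Lim_measure_incseq)
    show "incseq A" by (auto simp: incseq_def A_def)
    have "emeasure lborel (\<Union>n. A n) \<le> emeasure lborel {0<..1 :: real}"
      by (rule emeasure_mono) (auto simp: A_def)
    then show "emeasure lborel (\<Union>n. A n) \<noteq> \<infinity>" by (auto simp: top_unique)
  qed (use A in auto)
  moreover have "(\<Union>n. A n) = {0<..1}"
    by (auto simp: A_def intro: real_arch_simple)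
  ultimately have "(\<lambda>n. measure lborel (A n)) \<longlonglongrightarrow> 1" by simp
  then have "eventually (\<lambda>n. measure lborel (A n) > 3 / 4) sequentially"
    by (rule order_tendstoD) simp
  then obtain n where n: "measure lborel (A n) > 3 / 4"
    by (auto simp: eventually_sequentially)
  have "\<bar>f h\<bar> \<le> 2 * real n" if h: "0 < h" "h \<le> 1 / 4" for h
  proof -
    define S where "S = (\<lambda>x. x + h) -` A n"
    have S: "S \<in> sets lborel"
      using A[of n] unfolding S_def by (auto intro!: measurable_sets_borel[where M = borel])
    have "emeasure lborel S = emeasure lborel (A n)"
    proof -
      have "emeasure lborel (A n) = emeasure (distr lborel borel ((+) h)) (A n)"
        by (simp add: lborel_distr_plus)
      also have "\<dots> = emeasure lborel S"
        using A by (subst emeasure_distr) (auto simp: S_def add.commute vimage_def)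
      finally show ?thesis by simp
    qed
    then have mS: "measure lborel S = measure lborel (A n)" by (simp add: measure_def)
    \<comment> \<open>If they were disjoint, the two sets, each of measure above 3/4, would fit into
      an interval of length 5/4.\<close>
    have "A n \<inter> S \<noteq> {}"
    proof
      assume disj: "A n \<inter> S = {}"
      have sub: "A n \<subseteq> {- 1 .. 2}" "S \<subseteq> {- 1 .. 2}" using h by (auto simp: A_def S_def)
      have "measure lborel (A n \<union> S) = measure lborel (A n) + measure lborel S"
        using fmeasurableD2[OF fm[OF A sub(1)]] fmeasurableD2[OF fm[OF S sub(2)]] A[of n] S disj
        by (intro measure_Union) simp_all
      moreover have "measure lborel (A n \<union> S) \<le> measure lborel {- 1 / 4 .. 1 :: real}"
      proof (rule measure_mono_fmeasurable)
        show "A n \<union> S \<subseteq> {- 1 / 4 .. 1}" using h by (auto simp: A_def S_def)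
        show "A n \<union> S \<in> sets lborel" using A S by simp
        show "{- 1 / 4 .. 1 :: real} \<in> fmeasurable lborel" by (rule fm) auto
      qed
      moreover have "measure lborel {- 1 / 4 .. 1 :: real} = 5 / 4" by simp
      ultimately show False using n mS by linarith
    qed
    then obtain x where "x \<in> A n" "x + h \<in> A n" by (auto simp: S_def)
    then show ?thesis using add[of x h] h by (auto simp: A_def)
  qed
  then show ?thesis by (intro additive_bounded_imp_linear[of f "1/4" "2 * real n"] add t) auto
qed

section \<open>Inner product spaces\<close>

lemma Cring_simps [simp]:
  "carrier Cring = UNIV" "x \<otimes>\<^bsub>Cring\<^esub> y = x * y" "x \<oplus>\<^bsub>Cring\<^esub> y = x + y"
  "\<one>\<^bsub>Cring\<^esub> = 1" "\<zero>\<^bsub>Cring\<^esub> = 0"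
  by (simp_all add: ring_of_type_algebra_def)

text \<open>The scalar core of Cauchy-Schwarz: \<open>a\<close>, \<open>b\<close>, \<open>c\<close>
  stand for \<langle>f, f\<rangle>, \<langle>f, g\<rangle>, \<langle>g, g\<rangle>, and the
  assumption says that f + z g has nonnegative square. Stated for numbers, it serves both the fibres
  and the form on formal sums, which is only semidefinite; there \<open>c = 0\<close> does not mean
  g = 0 and needs its own argument.\<close>

lemma semi_inner_Cauchy_Schwarz:
  fixes b :: complex
  assumes "\<And>z. a + 2 * Re (z * b) + (cmod z)\<^sup>2 * c \<ge> 0" and "c \<ge> 0"
  shows "(cmod b)\<^sup>2 \<le> a * c"
proof (cases "c = 0")
  case True
  have "b = 0"
  proof (rule ccontr)
    assume "b \<noteq> 0"
    \<comment> \<open>With \<open>c = 0\<close> the expression is affine in \<open>z\<close>; this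
      \<open>z\<close> brings it down to \<open>- a - 2\<close>, negative because
      \<open>z = 0\<close> gives \<open>a \<ge> 0\<close>.\<close>
    define z where "z = - of_real ((a + 1) / (cmod b)\<^sup>2) * cnj b"
    have "z * b = - of_real ((a + 1) / (cmod b)\<^sup>2 * (cmod b)\<^sup>2)"
      by (simp only: z_def of_real_mult complex_norm_square) (simp add: mult_ac)
    also have "\<dots> = - of_real (a + 1)" using \<open>b \<noteq> 0\<close> by simp
    finally have "z * b = - of_real (a + 1)" .
    then have "Re (z * b) = - (a + 1)" by simp
    with assms(1)[of z] assms(1)[of 0] True show False by simp
  qed
  with True show ?thesis by simp
next
  case False
  with assms(2) have c: "c > 0" by simp
  \<comment> \<open>The minimiser of the quadratic expression.\<close>
  define z where "z = - of_real (1 / c) * cnj b"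
  have "z * b = - of_real ((cmod b)\<^sup>2 / c)"
    by (simp only: z_def of_real_divide complex_norm_square) (simp add: mult_ac)
  then have re: "Re (z * b) = - ((cmod b)\<^sup>2 / c)" by simp
  have "cmod z = cmod b / c" using c by (simp add: z_def norm_mult norm_divide)
  then have "(cmod z)\<^sup>2 * c = (cmod b)\<^sup>2 / c"
    using c by (simp add: power_divide power2_eq_square)
  with assms(1)[of z] re have "a - (cmod b)\<^sup>2 / c \<ge> 0" by simp
  with c show ?thesis by (simp add: field_simps)
qed


context inner_product_space
begin

lemma smult_in_carrier [simp, intro]: "x \<in> carrier H \<Longrightarrow> c \<odot> x \<in> carrier H"
  by simp

lemma smult_add_left: "x \<in> carrier H \<Longrightarrow> (c + d) \<odot> x = c \<odot> x \<oplus> d \<odot> x"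
  using smult_l_distr[of c d x] by simp

lemma smult_add_right: "\<lbrakk>x \<in> carrier H; y \<in> carrier H\<rbrakk> \<Longrightarrow> c \<odot> (x \<oplus> y) = c \<odot> x \<oplus> c \<odot> y"
  using smult_r_distr[of c x y] by simp

lemma smult_smult: "x \<in> carrier H \<Longrightarrow> c \<odot> (d \<odot> x) = (c * d) \<odot> x"
  using smult_assoc1[of c d x] by simp

lemma smult_1 [simp]: "x \<in> carrier H \<Longrightarrow> 1 \<odot> x = x"
  using smult_one[of x] by simp

lemma smult_0 [simp]: "x \<in> carrier H \<Longrightarrow> 0 \<odot> x = \<zero>"
  using smult_l_null[of x] by simp

lemma smult_zero [simp]: "c \<odot> \<zero> = \<zero>"
  using smult_r_null[of c] by simp

lemma uminus_eq_smult: "x \<in> carrier H \<Longrightarrow> \<ominus> x = (- 1) \<odot> x"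
proof -
  assume x: "x \<in> carrier H"
  have "x \<oplus> (- 1) \<odot> x = (1 + (- 1)) \<odot> x" using x smult_add_left[of x 1 "- 1"] by simp
  then have "x \<oplus> (- 1) \<odot> x = \<zero>" using x by simp
  then show ?thesis using x by (simp add: M.minus_equality M.a_comm)
qed

lemma minus_in_carrier [simp, intro]:
  "\<lbrakk>x \<in> carrier H; y \<in> carrier H\<rbrakk> \<Longrightarrow> x \<ominus> y \<in> carrier H"
  by (rule M.minus_closed)

lemma minus_eq_smult: "\<lbrakk>x \<in> carrier H; y \<in> carrier H\<rbrakk> \<Longrightarrow> x \<ominus> y = x \<oplus> (- 1) \<odot> y"
  by (simp add: a_minus_def uminus_eq_smult)

lemma cinner_add_left:
  "\<lbrakk>x \<in> carrier H; y \<in> carrier H; z \<in> carrier H\<rbrakk>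
    \<Longrightarrow> cinner H (x \<oplus> y) z = cinner H x z + cinner H y z"
  using cinner_commute[of z "x \<oplus> y"] cinner_commute[of z x] cinner_commute[of z y]
  by (simp add: cinner_add_right)

lemma cinner_smult_left:
  "\<lbrakk>x \<in> carrier H; y \<in> carrier H\<rbrakk> \<Longrightarrow> cinner H (c \<odot> x) y = cnj c * cinner H x y"
  using cinner_commute[of y "c \<odot> x"] cinner_commute[of y x] by (simp add: cinner_smult_right)

lemma cinner_zero_right [simp]: "x \<in> carrier H \<Longrightarrow> cinner H x \<zero> = 0"
  using cinner_smult_right[of x \<zero> 0] by simp

lemma cinner_zero_left [simp]: "x \<in> carrier H \<Longrightarrow> cinner H \<zero> x = 0"
  using cinner_smult_left[of \<zero> x 0] by simp

lemma cinner_minus_right: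
  "\<lbrakk>x \<in> carrier H; y \<in> carrier H; z \<in> carrier H\<rbrakk>
    \<Longrightarrow> cinner H x (y \<ominus> z) = cinner H x y - cinner H x z"
  by (simp add: minus_eq_smult cinner_add_right cinner_smult_right)

lemma cinner_minus_left:
  "\<lbrakk>x \<in> carrier H; y \<in> carrier H; z \<in> carrier H\<rbrakk>
    \<Longrightarrow> cinner H (x \<ominus> y) z = cinner H x z - cinner H y z"
  by (simp add: minus_eq_smult cinner_add_left cinner_smult_left)

lemmas cinner_simps = cinner_add_left cinner_add_right cinner_smult_left cinner_smult_right
  cinner_minus_left cinner_minus_right

lemma Im_cinner_self: "x \<in> carrier H \<Longrightarrow> Im (cinner H x x) = 0"
  using cinner_commute[of x x] by (simp add: complex_eq_iff)

lemma Re_cinner_self_nonneg: "x \<in> carrier H \<Longrightarrow> Re (cinner H x x) \<ge> 0"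
  using cinner_pos[of x] by (cases "x = \<zero>") auto

lemma hnorm_nonneg [simp]: "x \<in> carrier H \<Longrightarrow> hnorm H x \<ge> 0"
  by (simp add: hnorm_def Re_cinner_self_nonneg)

lemma hnorm_power2: "x \<in> carrier H \<Longrightarrow> (hnorm H x)\<^sup>2 = Re (cinner H x x)"
  by (simp add: hnorm_def Re_cinner_self_nonneg)

lemma cinner_self: "x \<in> carrier H \<Longrightarrow> cinner H x x = of_real ((hnorm H x)\<^sup>2)"
  by (simp only: hnorm_power2) (simp add: complex_eq_iff Im_cinner_self)

lemma hnorm_eq_0_iff [simp]: "x \<in> carrier H \<Longrightarrow> hnorm H x = 0 \<longleftrightarrow> x = \<zero>"
  using cinner_pos[of x] by (cases "x = \<zero>") (auto simp: hnorm_def)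

lemma Re_cinner_commute:
  "\<lbrakk>x \<in> carrier H; y \<in> carrier H\<rbrakk> \<Longrightarrow> Re (cinner H y x) = Re (cinner H x y)"
  by (simp add: cinner_commute[of x y])

lemma hnorm_add_power2:
  "\<lbrakk>x \<in> carrier H; y \<in> carrier H\<rbrakk>
    \<Longrightarrow> (hnorm H (x \<oplus> y))\<^sup>2 = (hnorm H x)\<^sup>2 + 2 * Re (cinner H x y) + (hnorm H y)\<^sup>2"
  by (simp add: hnorm_power2 cinner_simps Re_cinner_commute[of x y])

lemma hnorm_minus_power2:
  "\<lbrakk>x \<in> carrier H; y \<in> carrier H\<rbrakk>
    \<Longrightarrow> (hnorm H (x \<ominus> y))\<^sup>2 = (hnorm H x)\<^sup>2 - 2 * Re (cinner H x y) + (hnorm H y)\<^sup>2"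
  by (simp add: hnorm_power2 cinner_simps Re_cinner_commute[of x y])

lemma hnorm_smult: "x \<in> carrier H \<Longrightarrow> hnorm H (c \<odot> x) = cmod c * hnorm H x"
proof -
  assume x: "x \<in> carrier H"
  have "cinner H (c \<odot> x) (c \<odot> x) = c * cnj c * cinner H x x"
    using x by (simp add: cinner_simps)
  also have "\<dots> = of_real ((cmod c)\<^sup>2 * (hnorm H x)\<^sup>2)"
    by (simp only: cinner_self[OF x] of_real_mult complex_norm_square)
  finally have "(hnorm H (c \<odot> x))\<^sup>2 = (cmod c * hnorm H x)\<^sup>2"
    using x by (simp add: hnorm_power2[of "c \<odot> x"] power_mult_distrib)
  then show ?thesis by (rule power2_eq_imp_eq) (use x in simp_all)
qed

lemma Cauchy_Schwarz:
  assumes "x \<in> carrier H" "y \<in> carrier H"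
  shows "cmod (cinner H x y) \<le> hnorm H x * hnorm H y"
proof -
  have "(cmod (cinner H x y))\<^sup>2 \<le> (hnorm H x)\<^sup>2 * (hnorm H y)\<^sup>2"
  proof (rule semi_inner_Cauchy_Schwarz)
    fix z
    have "0 \<le> (hnorm H (x \<oplus> z \<odot> y))\<^sup>2" by simp
    also have "\<dots> = (hnorm H x)\<^sup>2 + 2 * Re (z * cinner H x y) + (cmod z)\<^sup>2 * (hnorm H y)\<^sup>2"
      using assms by (simp add: hnorm_add_power2 cinner_smult_right hnorm_smult power_mult_distrib)
    finally show "0 \<le> (hnorm H x)\<^sup>2 + 2 * Re (z * cinner H x y) + (cmod z)\<^sup>2 * (hnorm H y)\<^sup>2" .
  qed simp
  then have "(cmod (cinner H x y))\<^sup>2 \<le> (hnorm H x * hnorm H y)\<^sup>2"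
    by (simp only: power_mult_distrib)
  then show ?thesis by (rule power2_le_imp_le) (use assms in simp)
qed

lemma hnorm_triangle:
  assumes "x \<in> carrier H" "y \<in> carrier H"
  shows "hnorm H (x \<oplus> y) \<le> hnorm H x + hnorm H y"
proof (rule power2_le_imp_le)
  have "Re (cinner H x y) \<le> hnorm H x * hnorm H y"
    using Cauchy_Schwarz[OF assms] complex_Re_le_cmod order_trans by blast
  then show "(hnorm H (x \<oplus> y))\<^sup>2 \<le> (hnorm H x + hnorm H y)\<^sup>2"
    using assms by (simp add: hnorm_add_power2 power2_sum)
  show "0 \<le> hnorm H x + hnorm H y" using assms by simp
qed

lemma hnorm_minus_commute:
  assumes "x \<in> carrier H" "y \<in> carrier H"
  shows "hnorm H (x \<ominus> y) = hnorm H (y \<ominus> x)"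
proof -
  have "(hnorm H (x \<ominus> y))\<^sup>2 = (hnorm H (y \<ominus> x))\<^sup>2"
    using assms by (simp add: hnorm_minus_power2 Re_cinner_commute[of x y])
  then show ?thesis by (rule power2_eq_imp_eq) (use assms in simp_all)
qed

lemma minus_eq_zero_iff [simp]:
  assumes "x \<in> carrier H" "y \<in> carrier H"
  shows "x \<ominus> y = \<zero> \<longleftrightarrow> x = y"
proof
  assume "x \<ominus> y = \<zero>"
  then have "\<ominus> (\<ominus> y) = x"
    using assms by (intro M.minus_equality) (simp_all add: a_minus_def)
  then show "x = y" using assms by simp
qed (use assms in \<open>simp add: a_minus_def M.r_neg\<close>)

text \<open>Turns identities between vectors into identities between complex numbers, which
  simplification settles; it replaces rearrangements in the abelian group of
  \<open>H\<close>.\<close>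

lemma cinner_eqI:
  assumes "x \<in> carrier H" "y \<in> carrier H" "\<And>w. w \<in> carrier H \<Longrightarrow> cinner H x w = cinner H y w"
  shows "x = y"
proof -
  have "cinner H (x \<ominus> y) (x \<ominus> y) = 0"
    using assms(3)[of "x \<ominus> y"] assms(1,2) by (simp add: cinner_minus_left)
  then have "hnorm H (x \<ominus> y) = 0" by (simp add: hnorm_def)
  then show ?thesis using assms by simp
qed

lemma minus_add_minus:
  assumes "x \<in> carrier H" "y \<in> carrier H" "z \<in> carrier H"
  shows "(x \<ominus> y) \<oplus> (y \<ominus> z) = x \<ominus> z"
  using assms by (intro cinner_eqI) (simp_all add: cinner_add_left cinner_minus_left)

lemma hnorm_triangle_minus:
  assumes "x \<in> carrier H" "y \<in> carrier H" "z \<in> carrier H"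
  shows "hnorm H (x \<ominus> z) \<le> hnorm H (x \<ominus> y) + hnorm H (y \<ominus> z)"
  using hnorm_triangle[of "x \<ominus> y" "y \<ominus> z"] assms by (simp add: minus_add_minus)

lemma hdist_eq [simp]: "\<lbrakk>x \<in> carrier H; y \<in> carrier H\<rbrakk> \<Longrightarrow> hdist H x y = hnorm H (x \<ominus> y)"
  by (simp add: hdist_def)

lemma Metric_space_hdist: "Metric_space (carrier H) (hdist H)"
proof
  show "0 \<le> hdist H x y" for x y by (simp add: hdist_def)
  show "hdist H x y = hdist H y x" for x y by (auto simp: hdist_def hnorm_minus_commute)
  show "hdist H x y = 0 \<longleftrightarrow> x = y" if "x \<in> carrier H" "y \<in> carrier H" for x y
    using that by simp
  show "hdist H x z \<le> hdist H x y + hdist H y z"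
    if "x \<in> carrier H" "y \<in> carrier H" "z \<in> carrier H" for x y z
    using that hnorm_triangle_minus by simp
qed

end

section \<open>Inner products of elementary tensors\<close>

text \<open>\<open>v\<close> is the linear combination of the \<open>y i\<close> with coefficients
  \<open>c i\<close>, described by its inner products alone.\<close>

lemma (in inner_product_space) linear_combination_exists:
  assumes "finite I" "\<And>i. i \<in> I \<Longrightarrow> y i \<in> carrier H"
  shows "\<exists>v\<in>carrier H. \<forall>w\<in>carrier H. cinner H w v = (\<Sum>i\<in>I. c i * cinner H w (y i))"
  using assms
proof (induction I)
  case empty
  then show ?case by (intro bexI[of _ "\<zero>"]) auto
next
  case (insert i I)
  then obtain v where "v \<in> carrier H"
    and "\<forall>w\<in>carrier H. cinner H w v = (\<Sum>i\<in>I. c i * cinner H w (y i))" by auto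
  with insert show ?case
    by (intro bexI[of _ "c i \<odot> y i \<oplus> v"]) (auto simp: cinner_simps)
qed

text \<open>The double sum is the squared norm of the linear combination of the \<open>y p\<close>
  with coefficients \<open>c p\<close>.\<close>

lemma (in inner_product_space) Gram_psd:
  assumes "finite I" "\<And>i. i \<in> I \<Longrightarrow> y i \<in> carrier H"
  shows "0 \<le> Re (\<Sum>p\<in>I. \<Sum>q\<in>I. cnj (c p) * c q * cinner H (y p) (y q))"
proof -
  obtain v where v: "v \<in> carrier H"
    and *: "\<And>w. w \<in> carrier H \<Longrightarrow> cinner H w v = (\<Sum>i\<in>I. c i * cinner H w (y i))"
    using linear_combination_exists[of I y c, OF assms] by blast
  have "cinner H v v = (\<Sum>q\<in>I. c q * cinner H v (y q))" using v * by blast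
  also have "\<dots> = (\<Sum>q\<in>I. c q * cnj (cinner H (y q) v))"
    using v assms(2) by (intro sum.cong arg_cong2[of _ _ _ _ "(*)"] refl cinner_commute)
  also have "\<dots> = cnj (\<Sum>p\<in>I. cnj (c p) * cinner H (y p) v)"
    by simp
  also have "(\<Sum>p\<in>I. cnj (c p) * cinner H (y p) v)
      = (\<Sum>p\<in>I. \<Sum>q\<in>I. cnj (c p) * c q * cinner H (y p) (y q))"
    using assms by (intro sum.cong) (simp_all add: * sum_distrib_left mult.assoc)
  finally have "Re (cinner H v v)
      = Re (\<Sum>p\<in>I. \<Sum>q\<in>I. cnj (c p) * c q * cinner H (y p) (y q))"
    by (simp del: cnj_sum)
  then show ?thesis using Re_cinner_self_nonneg[OF v] by simp
qed

text \<open>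
  Induction on \<open>I\<close>: splitting each \<open>x p\<close> into its component along \<open>x a\<close> and the orthogonal rest \<open>x' p\<close>
  splits off a multiple of a Gram form of \<open>y\<close>, and \<open>x' a = 0\<close> leaves a sum over the smaller index set.
\<close>

lemma Schur_product_psd:
  assumes "inner_product_space H" "inner_product_space K"
    and "finite I" "\<And>i. i \<in> I \<Longrightarrow> x i \<in> carrier H" "\<And>i. i \<in> I \<Longrightarrow> y i \<in> carrier K"
  shows "0 \<le> Re (\<Sum>p\<in>I. \<Sum>q\<in>I. cinner H (x p) (x q) * cinner K (y p) (y q))"
  using assms(3-5)
\<comment> \<open>\<open>x\<close> is generalised because the induction hypothesis is applied to the
  orthogonal rests \<open>x'\<close>.\<close>
proof (induction I arbitrary: x)
  case empty
  then show ?case by simp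
next
  case (insert a I)
  interpret H: inner_product_space H by fact
  interpret K: inner_product_space K by fact
  show ?case
  proof (cases "x a = \<zero>\<^bsub>H\<^esub>")
    case True
    have "(\<Sum>p\<in>insert a I. \<Sum>q\<in>insert a I. cinner H (x p) (x q) * cinner K (y p) (y q))
        = (\<Sum>p\<in>I. \<Sum>q\<in>I. cinner H (x p) (x q) * cinner K (y p) (y q))"
      using insert.hyps insert.prems(1) True
      by (intro sum.mono_neutral_cong_right sum.neutral ballI) auto
    also have "0 \<le> Re \<dots>" by (rule insert.IH) (use insert.prems in auto)
    finally show ?thesis .
  next
    case False
    let ?J = "insert a I"
    define N where "N = (hnorm H (x a))\<^sup>2"
    have N: "cinner H (x a) (x a) = of_real N" "N \<noteq> 0" "N \<ge> 0"
      using insert.prems False by (simp_all add: N_def H.cinner_self)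
    define c where "c p = cinner H (x a) (x p) / of_real N" for p
    define x' where "x' p = x p \<ominus>\<^bsub>H\<^esub> c p \<odot>\<^bsub>H\<^esub> x a" for p
    have x': "x' p \<in> carrier H" if "p \<in> ?J" for p
      using that insert.prems by (auto simp: x'_def)
    have inner: "cinner H (x p) (x q) = cinner H (x' p) (x' q) + of_real N * (cnj (c p) * c q)"
      if "p \<in> ?J" "q \<in> ?J" for p q
    proof -
      have "cinner H (x p) (x a) = of_real N * cnj (c p)" "cinner H (x a) (x q) = of_real N * c q"
        using that insert.prems N H.cinner_commute[of "x a" "x p"] by (auto simp: c_def)
      then show ?thesis
        using that insert.prems N by (auto simp: x'_def H.cinner_simps algebra_simps)
    qed
    have a1: "cinner H (x' a) (x' q) = 0" if "q \<in> ?J" for q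
      using inner[of a q] that N by (simp add: c_def)
    have a2: "cinner H (x' q) (x' a) = 0" if "q \<in> ?J" for q
      using a1[OF that] H.cinner_commute[of "x' a" "x' q"] x'[OF that] x'[of a] by simp
    have "(\<Sum>p\<in>?J. \<Sum>q\<in>?J. cinner H (x p) (x q) * cinner K (y p) (y q))
        = (\<Sum>p\<in>?J. \<Sum>q\<in>?J. cinner H (x' p) (x' q) * cinner K (y p) (y q))
          + of_real N * (\<Sum>p\<in>?J. \<Sum>q\<in>?J. cnj (c p) * c q * cinner K (y p) (y q))"
      unfolding sum_distrib_left sum.distrib[symmetric]
      by (intro sum.cong refl) (simp add: inner algebra_simps)
    also have "(\<Sum>p\<in>?J. \<Sum>q\<in>?J. cinner H (x' p) (x' q) * cinner K (y p) (y q))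
        = (\<Sum>p\<in>I. \<Sum>q\<in>I. cinner H (x' p) (x' q) * cinner K (y p) (y q))"
      using insert.hyps a1 a2
      by (intro sum.mono_neutral_cong_right sum.neutral ballI) auto
    finally have eq: "(\<Sum>p\<in>?J. \<Sum>q\<in>?J. cinner H (x p) (x q) * cinner K (y p) (y q))
        = (\<Sum>p\<in>I. \<Sum>q\<in>I. cinner H (x' p) (x' q) * cinner K (y p) (y q))
          + of_real N * (\<Sum>p\<in>?J. \<Sum>q\<in>?J. cnj (c p) * c q * cinner K (y p) (y q))" .
    have "0 \<le> Re (\<Sum>p\<in>I. \<Sum>q\<in>I. cinner H (x' p) (x' q) * cinner K (y p) (y q))"
      by (rule insert.IH) (use x' insert.prems in auto)
    moreover have "0 \<le> Re (\<Sum>p\<in>?J. \<Sum>q\<in>?J. cnj (c p) * c q * cinner K (y p) (y q))"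
      by (rule K.Gram_psd) (use insert in auto)
    ultimately show ?thesis using N(3)
      by (simp only: eq plus_complex.sel Re_complex_of_real Im_complex_of_real times_complex.sel)
        simp
  qed
qed


section \<open>The positive semidefinite form on formal sums\<close>

lemma formal_inner_superset:
  assumes "finite I" "Poly_Mapping.keys f \<subseteq> I" "Poly_Mapping.keys g \<subseteq> I"
  shows "formal_inner H K f g = (\<Sum>p\<in>I. \<Sum>q\<in>I. cnj (Poly_Mapping.lookup f p) * Poly_Mapping.lookup g q *
        (cinner H (fst p) (fst q) * cinner K (snd p) (snd q)))"
proof -
  have "formal_inner H K f g = (\<Sum>p\<in>Poly_Mapping.keys f. \<Sum>q\<in>I. cnj (Poly_Mapping.lookup f p) * Poly_Mapping.lookup g q *
        (cinner H (fst p) (fst q) * cinner K (snd p) (snd q)))"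
    unfolding formal_inner_def using assms
    by (intro sum.cong refl sum.mono_neutral_left) (auto simp: in_keys_iff)
  also have "\<dots> = (\<Sum>p\<in>I. \<Sum>q\<in>I. cnj (Poly_Mapping.lookup f p) * Poly_Mapping.lookup g q *
        (cinner H (fst p) (fst q) * cinner K (snd p) (snd q)))"
    using assms by (intro sum.mono_neutral_left) (auto simp: in_keys_iff)
  finally show ?thesis .
qed

lemma formal_inner_zero [simp]: "formal_inner H K 0 f = 0" "formal_inner H K f 0 = 0"
  by (simp_all add: formal_inner_def)

text \<open>Cancellation can shrink the keys of \<open>f - g\<close>, so the sums are first extended
  to one index set common to all arguments; there the identity holds term by term.\<close>

lemma formal_inner_diff_left:
  "formal_inner H K (f - g) h = formal_inner H K f h - formal_inner H K g h"
proof -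
  let ?I = "Poly_Mapping.keys f \<union> Poly_Mapping.keys g \<union> Poly_Mapping.keys h"
  have I: "finite ?I" "Poly_Mapping.keys (f - g) \<subseteq> ?I" "Poly_Mapping.keys f \<subseteq> ?I"
    "Poly_Mapping.keys g \<subseteq> ?I" "Poly_Mapping.keys h \<subseteq> ?I"
    using keys_diff[of f g] by auto
  show ?thesis
    by (simp only: formal_inner_superset[OF I(1) _ I(5)] I lookup_minus complex_cnj_diff
        left_diff_distrib sum_subtractf)
qed

lemma formal_inner_diff_right:
  "formal_inner H K h (f - g) = formal_inner H K h f - formal_inner H K h g"
proof -
  let ?I = "Poly_Mapping.keys f \<union> Poly_Mapping.keys g \<union> Poly_Mapping.keys h"
  have I: "finite ?I" "Poly_Mapping.keys (f - g) \<subseteq> ?I" "Poly_Mapping.keys f \<subseteq> ?I"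
    "Poly_Mapping.keys g \<subseteq> ?I" "Poly_Mapping.keys h \<subseteq> ?I"
    using keys_diff[of f g] by auto
  show ?thesis
    by (simp only: formal_inner_superset[OF I(1) I(5)] I lookup_minus
        left_diff_distrib right_diff_distrib sum_subtractf)
qed

lemma formal_sums_diff: "\<lbrakk>f \<in> formal_sums H K; g \<in> formal_sums H K\<rbrakk> \<Longrightarrow> f - g \<in> formal_sums H K"
  using keys_diff[of f g] by (auto simp: formal_sums_def)

text \<open>The matrix of the form is the entrywise product of the Gram matrices of the first and of
  the second tensor factors; its positivity is the Schur product theorem, and the scalar inequality
  does the rest.\<close>

lemma formal_inner_Cauchy_Schwarz:
  assumes "inner_product_space H" "inner_product_space K"
    and "f \<in> formal_sums H K" "g \<in> formal_sums H K"
  shows "(cmod (formal_inner H K f g))\<^sup>2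
    \<le> Re (formal_inner H K f f) * Re (formal_inner H K g g)"
    and "0 \<le> Re (formal_inner H K f f)"
proof -
  interpret H: inner_product_space H by fact
  interpret K: inner_product_space K by fact
  define I where "I = Poly_Mapping.keys f \<union> Poly_Mapping.keys g"
  have I: "finite I" "Poly_Mapping.keys f \<subseteq> I" "Poly_Mapping.keys g \<subseteq> I"
    "I \<subseteq> carrier H \<times> carrier K"
    using assms(3,4) by (auto simp: I_def formal_sums_def)
  define G where "G p q = cinner H (fst p) (fst q) * cinner K (snd p) (snd q)" for p q
  \<comment> \<open>The form on arbitrary coefficient functions over the fixed index set
    \<open>I\<close>, so that f + z g can be handled without building a finitely supported
    map.\<close>
  define F where "F a b = (\<Sum>p\<in>I. \<Sum>q\<in>I. cnj (a p) * b q * G p q)" for a b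
  have G_comm: "G q p = cnj (G p q)" if "p \<in> I" "q \<in> I" for p q
  proof -
    have "p \<in> carrier H \<times> carrier K" "q \<in> carrier H \<times> carrier K" using that I(4) by auto
    then show ?thesis
      using H.cinner_commute[of "fst p" "fst q"] K.cinner_commute[of "snd p" "snd q"]
      by (simp add: G_def mem_Times_iff)
  qed
  have psd: "0 \<le> Re (F a a)" for a
  proof -
    \<comment> \<open>The coefficients are absorbed into the second tensor factor, which yields the
      unweighted sum of \<open>Schur_product_psd\<close>.\<close>
    have "cinner K (a p \<odot>\<^bsub>K\<^esub> snd p) (a q \<odot>\<^bsub>K\<^esub> snd q) = cnj (a p) * a q * cinner K (snd p) (snd q)"
      if "p \<in> I" "q \<in> I" for p q
    proof -
      have "snd p \<in> carrier K" "snd q \<in> carrier K" using that I(4) by auto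
      then show ?thesis by (simp add: K.cinner_simps)
    qed
    then have *: "F a a = (\<Sum>p\<in>I. \<Sum>q\<in>I. cinner H (fst p) (fst q)
        * cinner K (a p \<odot>\<^bsub>K\<^esub> snd p) (a q \<odot>\<^bsub>K\<^esub> snd q))"
      unfolding F_def G_def by (intro sum.cong refl) simp
    show ?thesis
      unfolding * by (rule Schur_product_psd[OF assms(1,2) I(1)]) (use I(4) in auto)
  qed
  have F_comm: "F b a = cnj (F a b)" for a b
  proof -
    have "cnj (b q) * a p * G q p = cnj (cnj (a p) * b q * G p q)" if "p \<in> I" "q \<in> I" for p q
      using G_comm[OF that] by (simp add: mult_ac)
    then show ?thesis
      unfolding F_def cnj_sum by (subst sum.swap) (intro sum.cong refl)
  qed
  let ?f = "Poly_Mapping.lookup f" and ?g = "Poly_Mapping.lookup g"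
  have eq: "formal_inner H K f g = F ?f ?g" "formal_inner H K f f = F ?f ?f"
    "formal_inner H K g g = F ?g ?g"
    unfolding F_def G_def using I by (simp_all only: formal_inner_superset)
  have "(cmod (F ?f ?g))\<^sup>2 \<le> Re (F ?f ?f) * Re (F ?g ?g)"
  proof (rule semi_inner_Cauchy_Schwarz)
    fix z
    define h where "h p = ?f p + z * ?g p" for p
    have "F h h = F ?f ?f + z * F ?f ?g + cnj z * F ?g ?f + (z * cnj z) * F ?g ?g"
      unfolding F_def sum_distrib_left sum.distrib[symmetric]
      by (intro sum.cong refl) (simp add: h_def algebra_simps)
    also have "z * cnj z = of_real ((cmod z)\<^sup>2)" by (rule complex_norm_square[symmetric])
    also have "cnj z * F ?g ?f = cnj (z * F ?f ?g)" by (simp add: F_comm[of ?f ?g])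
    finally have "Re (F h h) = Re (F ?f ?f) + 2 * Re (z * F ?f ?g) + (cmod z)\<^sup>2 * Re (F ?g ?g)"
      by (simp del: of_real_power)
    with psd[of h]
    show "0 \<le> Re (F ?f ?f) + 2 * Re (z * F ?f ?g) + (cmod z)\<^sup>2 * Re (F ?g ?g)"
      by simp
  qed (rule psd)
  then show "(cmod (formal_inner H K f g))\<^sup>2
    \<le> Re (formal_inner H K f f) * Re (formal_inner H K g g)" by (simp only: eq)
  show "0 \<le> Re (formal_inner H K f f)" by (simp only: eq psd)
qed

text \<open>By Cauchy-Schwarz it is enough that one sequence is null while the squares of the other
  converge. The condition \<open>a * b = 0\<close> covers a null sequence on either side or on
  both.\<close>

lemma formal_inner_tendsto_0:
  assumes "inner_product_space H" "inner_product_space K"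
    and "\<And>n. f n \<in> formal_sums H K" "\<And>n. g n \<in> formal_sums H K"
    and f: "(\<lambda>n. formal_inner H K (f n) (f n)) \<longlonglongrightarrow> a"
    and g: "(\<lambda>n. formal_inner H K (g n) (g n)) \<longlonglongrightarrow> b"
    and "a * b = 0" "Im a = 0" "Im b = 0"
  shows "(\<lambda>n. formal_inner H K (f n) (g n)) \<longlonglongrightarrow> 0"
proof -
  have "(\<lambda>n. Re (formal_inner H K (f n) (f n)) * Re (formal_inner H K (g n) (g n)))
      \<longlonglongrightarrow> Re a * Re b"
    by (intro tendsto_intros f g)
  moreover have "Re a * Re b = 0" using assms(7-9) by (auto simp: complex_eq_iff)
  ultimately have "(\<lambda>n. Re (formal_inner H K (f n) (f n)) * Re (formal_inner H K (g n) (g n))) \<longlonglongrightarrow> 0"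
    by simp
  then have "(\<lambda>n. (cmod (formal_inner H K (f n) (g n)))\<^sup>2) \<longlonglongrightarrow> 0"
    by (rule Lim_null_comparison[rotated])
      (auto intro!: always_eventually formal_inner_Cauchy_Schwarz assms)
  then have "(\<lambda>n. sqrt ((cmod (formal_inner H K (f n) (g n)))\<^sup>2)) \<longlonglongrightarrow> sqrt 0"
    by (rule tendsto_real_sqrt)
  then show ?thesis by (simp add: tendsto_norm_zero_iff)
qed

section \<open>Elementary tensors in the completion\<close>

lemma const_single_formal_cauchy:
  assumes "x \<in> carrier H" "y \<in> carrier K"
  shows "(\<lambda>n. Poly_Mapping.single (x, y) 1) \<in> formal_cauchy H K"
  using assms by (auto simp: formal_cauchy_def formal_sums_def)

text \<open>The representative is an arbitrary choice; its equivalence to the constant sequence is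
  the property through which it enters later arguments.\<close>

lemma pure_tensor_rep:
  assumes "x \<in> carrier H" "y \<in> carrier K"
  shows "((\<lambda>n. Poly_Mapping.single (x, y) 1), tensor_rep (pure_tensor H K x y)) \<in> formal_equiv H K"
proof -
  have "(\<lambda>n. Poly_Mapping.single (x, y) 1) \<in> pure_tensor H K x y"
    using const_single_formal_cauchy[OF assms]
    by (simp add: pure_tensor_def tensor_class_def formal_equiv_def)
  then have "tensor_rep (pure_tensor H K x y) \<in> pure_tensor H K x y"
    unfolding tensor_rep_def by (rule someI[where P = "\<lambda>\<sigma>. \<sigma> \<in> _"])
  then show ?thesis by (simp add: pure_tensor_def tensor_class_def)
qed

lemma pure_tensor_carrier:
  assumes "x \<in> carrier H" "y \<in> carrier K"
  shows "pure_tensor H K x y \<in> carrier (hilbert_tensor H K)"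
  unfolding pure_tensor_def tensor_class_def hilbert_tensor_def
  using const_single_formal_cauchy[OF assms] by (simp add: quotientI)

text \<open>For representatives \<open>r\<close>, \<open>r'\<close> of the two classes, \<langle>r,
  r'\<rangle> = \<langle>f, f'\<rangle> - \<langle>f, f' - r'\<rangle> - \<langle>f - r, f'\<rangle>
  + \<langle>f - r, f' - r'\<rangle> at each index. Each of the last three terms contains a null
  sequence, so the limit does not see the choice.\<close>

lemma cinner_pure_tensor:
  assumes HK: "inner_product_space H" "inner_product_space K"
    and xy: "x \<in> carrier H" "y \<in> carrier K" "x' \<in> carrier H" "y' \<in> carrier K"
  shows "cinner (hilbert_tensor H K) (pure_tensor H K x y) (pure_tensor H K x' y')
    = cinner H x x' * cinner K y y'"
proof -
  define f where "f = Poly_Mapping.single (x, y) (1 :: complex)"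
  define f' where "f' = Poly_Mapping.single (x', y') (1 :: complex)"
  define r where "r = tensor_rep (pure_tensor H K x y)"
  define r' where "r' = tensor_rep (pure_tensor H K x' y')"
  let ?i = "formal_inner H K"
  interpret H: inner_product_space H by fact
  interpret K: inner_product_space K by fact
  have e: "((\<lambda>n. f), r) \<in> formal_equiv H K" "((\<lambda>n. f'), r') \<in> formal_equiv H K"
    using pure_tensor_rep xy by (auto simp: f_def f'_def r_def r'_def)
  have fs: "f \<in> formal_sums H K" "f' \<in> formal_sums H K" "r n \<in> formal_sums H K"
    "r' n \<in> formal_sums H K" for n
    using e by (auto simp: formal_equiv_def formal_cauchy_def)
  have ds: "f - r n \<in> formal_sums H K" "f' - r' n \<in> formal_sums H K" for n
    by (auto intro: formal_sums_diff fs)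
  have d: "(\<lambda>n. ?i (f - r n) (f - r n)) \<longlonglongrightarrow> 0" "(\<lambda>n. ?i (f' - r' n) (f' - r' n)) \<longlonglongrightarrow> 0"
    using e by (auto simp: formal_equiv_def)
  have im: "Im (?i f f) = 0" "Im (?i f' f') = 0"
    using xy by (simp_all add: f_def f'_def formal_inner_def H.cinner_self K.cinner_self
      flip: of_real_mult of_real_power)
  have "(\<lambda>n. ?i f f' - ?i f (f' - r' n) - ?i (f - r n) f' + ?i (f - r n) (f' - r' n))
      \<longlonglongrightarrow> ?i f f' - 0 - 0 + 0"
    by (intro tendsto_add tendsto_diff tendsto_const)
      (rule formal_inner_tendsto_0[OF HK _ _ tendsto_const d(2)]
        formal_inner_tendsto_0[OF HK _ _ d(1) tendsto_const]
        formal_inner_tendsto_0[OF HK _ _ d(1) d(2)], (use im fs ds in simp_all))+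
  then have "(\<lambda>n. ?i (r n) (r' n)) \<longlonglongrightarrow> ?i f f'"
    by (simp add: formal_inner_diff_left formal_inner_diff_right)
  then have "lim (\<lambda>n. ?i (r n) (r' n)) = ?i f f'" by (rule limI)
  also have "?i f f' = cinner H x x' * cinner K y y'"
    by (simp add: f_def f'_def formal_inner_def)
  finally show ?thesis by (simp add: hilbert_tensor_def r_def r'_def)
qed

section \<open>Approximation by rational combinations of a total sequence\<close>

text \<open>The Gaussian rationals, parametrised by a countable type.\<close>

definition rat_complex :: "rat \<times> rat \<Rightarrow> complex" where
  "rat_complex r = Complex (of_rat (fst r)) (of_rat (snd r))"

lemma rat_complex_mult: "\<exists>r. rat_complex r = rat_complex p * rat_complex q"
  by (rule exI[of _ "(fst p * fst q - snd p * snd q, fst p * snd q + snd p * fst q)"])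
    (simp add: rat_complex_def complex_eq_iff of_rat_mult of_rat_diff of_rat_add)

lemma rat_complex_dense:
  assumes "d > 0"
  shows "\<exists>r. cmod (c - rat_complex r) < d"
proof -
  obtain p where p: "Re c - d / 2 < of_rat p" "of_rat p < Re c"
    using of_rat_dense[of "Re c - d / 2" "Re c"] assms by auto
  obtain q where q: "Im c - d / 2 < of_rat q" "of_rat q < Im c"
    using of_rat_dense[of "Im c - d / 2" "Im c"] assms by auto
  have "cmod (c - rat_complex (p, q)) \<le> \<bar>Re (c - rat_complex (p, q))\<bar> + \<bar>Im (c - rat_complex (p, q))\<bar>"
    by (rule cmod_le)
  also have "\<dots> < d" using p q by (simp add: rat_complex_def)
  finally show ?thesis by blast
qed

text \<open>The index lists form a countable type, so a union over all combinations preserves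
  measurability. Repeated indices are allowed, which makes a sum of combinations a concatenation of
  lists.\<close>

primrec rat_comb :: "'a hilb \<Rightarrow> (nat \<Rightarrow> 'a) \<Rightarrow> (nat \<times> rat \<times> rat) list \<Rightarrow> 'a" where
  "rat_comb H f [] = \<zero>\<^bsub>H\<^esub>"
| "rat_comb H f (p # l) = rat_complex (snd p) \<odot>\<^bsub>H\<^esub> f (fst p) \<oplus>\<^bsub>H\<^esub> rat_comb H f l"

context inner_product_space
begin

lemma rat_comb_closed:
  assumes "\<And>n. f n \<in> carrier H"
  shows "rat_comb H f l \<in> carrier H"
  using assms by (induction l) auto

lemma rat_comb_append:
  assumes "\<And>n. f n \<in> carrier H"
  shows "rat_comb H f (l @ l') = rat_comb H f l \<oplus> rat_comb H f l'"
  using assms by (induction l) (auto simp: rat_comb_closed M.a_assoc)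

lemma rat_comb_smult:
  assumes "\<And>n. f n \<in> carrier H"
  shows "\<exists>l'. rat_comb H f l' = rat_complex r \<odot> rat_comb H f l"
proof (induction l)
  case Nil
  then show ?case by (intro exI[of _ "[]"]) simp
next
  case (Cons p l)
  then obtain l' where "rat_comb H f l' = rat_complex r \<odot> rat_comb H f l" by blast
  moreover obtain q where "rat_complex q = rat_complex r * rat_complex (snd p)"
    using rat_complex_mult by blast
  ultimately have "rat_comb H f ((fst p, q) # l') = rat_complex r \<odot> rat_comb H f (p # l)"
    using assms by (simp add: smult_add_right smult_smult rat_comb_closed)
  then show ?case by blast
qed

text \<open>Separates the error made in the vector from the error made in the scalar.\<close>

lemma minus_smult_split:
  assumes "x \<in> carrier H" "y \<in> carrier H"
  shows "c \<odot> x \<ominus> d \<odot> y = c \<odot> (x \<ominus> y) \<oplus> (c - d) \<odot> y"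
  using assms by (intro cinner_eqI) (simp_all add: cinner_simps algebra_simps)

lemma add_minus_add:
  assumes "x \<in> carrier H" "y \<in> carrier H" "x' \<in> carrier H" "y' \<in> carrier H"
  shows "(x \<oplus> y) \<ominus> (x' \<oplus> y') = (x \<ominus> x') \<oplus> (y \<ominus> y')"
  using assms by (intro cinner_eqI) (simp_all add: cinner_simps)

text \<open>\<open>lin_span\<close> is a hull, so bounding it from above takes a submodule. The
  rational combinations need not be closed under complex scalars, but the set of vectors they
  approximate is.\<close>

lemma submodule_rat_comb_closure:
  assumes f: "\<And>n. f n \<in> carrier H"
  shows "submodule {v \<in> carrier H. \<forall>\<epsilon>>0. \<exists>l. hnorm H (v \<ominus> rat_comb H f l) < \<epsilon>} Cring H"
    (is "submodule ?D Cring H")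
proof -
  note cl = rat_comb_closed[of f, OF f]
  have zero: "\<zero> \<in> ?D"
  proof -
    have "hnorm H (\<zero> \<ominus> rat_comb H f []) = 0" by simp
    then show ?thesis
      by (intro CollectI conjI allI impI exI[of _ "[]"] M.zero_closed) (simp only:)
  qed
  have add: "a \<oplus> b \<in> ?D" if ab: "a \<in> ?D" "b \<in> ?D" for a b
  proof (intro CollectI conjI allI impI)
    show "a \<oplus> b \<in> carrier H" using ab by auto
    fix \<epsilon> :: real
    assume "\<epsilon> > 0"
    then have "\<epsilon> / 2 > 0" by simp
    then obtain l l' where l: "hnorm H (a \<ominus> rat_comb H f l) < \<epsilon> / 2"
      "hnorm H (b \<ominus> rat_comb H f l') < \<epsilon> / 2"
      using ab by blast
    have "hnorm H ((a \<oplus> b) \<ominus> rat_comb H f (l @ l'))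
        = hnorm H ((a \<ominus> rat_comb H f l) \<oplus> (b \<ominus> rat_comb H f l'))"
      using ab cl by (simp add: rat_comb_append[of f, OF f] add_minus_add)
    also have "\<dots> \<le> hnorm H (a \<ominus> rat_comb H f l) + hnorm H (b \<ominus> rat_comb H f l')"
      using ab cl by (intro hnorm_triangle) auto
    also have "\<dots> < \<epsilon>" using l by simp
    finally show "\<exists>l. hnorm H ((a \<oplus> b) \<ominus> rat_comb H f l) < \<epsilon>" by blast
  qed
  have smult: "c \<odot> a \<in> ?D" if a: "a \<in> ?D" for c a
  proof (intro CollectI conjI allI impI)
    show "c \<odot> a \<in> carrier H" using a by auto
    fix \<epsilon> :: real
    assume e: "\<epsilon> > 0"
    \<comment> \<open>Adding 1 keeps both denominators positive when \<open>c\<close> or the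
      combination vanishes. The combination is chosen before the scalar, since the tolerance for the
      scalar depends on its norm.\<close>
    then have "\<epsilon> / 2 / (cmod c + 1) > 0"
      by (intro divide_pos_pos add_nonneg_pos) auto
    then obtain l where l: "hnorm H (a \<ominus> rat_comb H f l) < \<epsilon> / 2 / (cmod c + 1)"
      using a by blast
    let ?q = "rat_comb H f l"
    have "0 < hnorm H ?q + 1" using hnorm_nonneg[OF cl] by (simp add: add_nonneg_pos)
    then have "\<epsilon> / 2 / (hnorm H ?q + 1) > 0" using e by (intro divide_pos_pos) auto
    then obtain r where r: "cmod (c - rat_complex r) < \<epsilon> / 2 / (hnorm H ?q + 1)"
      using rat_complex_dense by blast
    obtain l' where l': "rat_comb H f l' = rat_complex r \<odot> ?q"
      using rat_comb_smult[of f, OF f] by blast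
    have "hnorm H (c \<odot> a \<ominus> rat_comb H f l')
        = hnorm H (c \<odot> (a \<ominus> ?q) \<oplus> (c - rat_complex r) \<odot> ?q)"
      using a cl by (simp add: l' minus_smult_split)
    also have "\<dots> \<le> hnorm H (c \<odot> (a \<ominus> ?q)) + hnorm H ((c - rat_complex r) \<odot> ?q)"
      using a cl by (intro hnorm_triangle) auto
    also have "\<dots> = cmod c * hnorm H (a \<ominus> ?q) + cmod (c - rat_complex r) * hnorm H ?q"
      using a cl by (simp add: hnorm_smult)
    also have "\<dots> < \<epsilon> / 2 + \<epsilon> / 2"
    proof (rule add_le_less_mono)
      have "cmod c * hnorm H (a \<ominus> ?q) \<le> (cmod c + 1) * (\<epsilon> / 2 / (cmod c + 1))"
        using l a cl by (intro mult_mono) auto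
      also have "\<dots> = \<epsilon> / 2"
      proof -
        have "cmod c + 1 \<noteq> 0" using norm_ge_zero[of c] by linarith
        then show ?thesis by (metis mult.commute nonzero_eq_divide_eq)
      qed
      finally show "cmod c * hnorm H (a \<ominus> ?q) \<le> \<epsilon> / 2" .
      have "cmod (c - rat_complex r) * hnorm H ?q \<le> cmod (c - rat_complex r) * (hnorm H ?q + 1)"
        by (intro mult_left_mono) auto
      also have "\<dots> < \<epsilon> / 2"
        using r \<open>0 < hnorm H ?q + 1\<close> by (simp only: pos_less_divide_eq)
      finally show "cmod (c - rat_complex r) * hnorm H ?q < \<epsilon> / 2" .
    qed
    finally show "\<exists>l. hnorm H (c \<odot> a \<ominus> rat_comb H f l) < \<epsilon>" by auto
  qed
  show ?thesis
  proof (rule submoduleI)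
    show "\<ominus> a \<in> ?D" if "a \<in> ?D" for a
      using smult[OF that, of "- 1"] that by (simp add: uminus_eq_smult)
  qed (use zero add smult in auto)
qed

text \<open>Two approximations: \<open>v\<close> by an element of the span, which totality provides,
  and that element by a rational combination, since the span lies in \<open>D\<close> by minimality
  of the hull.\<close>

lemma rat_comb_dense:
  assumes tot: "total_in H (range f)" and v: "v \<in> carrier H" and e: "\<epsilon> > 0"
  shows "\<exists>l. hnorm H (v \<ominus> rat_comb H f l) < \<epsilon>"
proof -
  interpret Metric_space "carrier H" "hdist H" by (rule Metric_space_hdist)
  have f: "f n \<in> carrier H" for n using tot by (auto simp: total_in_def)
  define D where "D = {v \<in> carrier H. \<forall>\<epsilon>>0. \<exists>l. hnorm H (v \<ominus> rat_comb H f l) < \<epsilon>}"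
  have "f n \<in> D" for n
  proof -
    have "rat_comb H f [(n, 1, 0)] = f n"
      using f[of n] by (simp add: rat_complex_def flip: one_complex.code)
    then have "hnorm H (f n \<ominus> rat_comb H f [(n, 1, 0)]) = 0"
      using f[of n] by simp
    then show ?thesis
      unfolding D_def using f by (intro CollectI conjI allI impI exI[of _ "[(n, 1, 0)]"]) (simp only:)+
  qed
  then have "lin_span H (range f) \<subseteq> D"
    unfolding lin_span_def using submodule_rat_comb_closure[of f, OF f]
    by (intro hull_minimal) (auto simp: D_def)
  moreover have "v \<in> mtopology closure_of lin_span H (range f)"
    using tot v by (simp add: total_in_def)
  then have "\<forall>r>0. \<exists>w\<in>lin_span H (range f). w \<in> mball v r"
    unfolding metric_closure_of by blast
  then obtain w where "w \<in> lin_span H (range f)" "w \<in> mball v (\<epsilon> / 2)"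
    using e half_gt_zero by blast
  ultimately have w: "w \<in> D" "w \<in> carrier H" "hnorm H (v \<ominus> w) < \<epsilon> / 2"
    using v by auto
  moreover have "\<epsilon> / 2 > 0" using e by simp
  ultimately obtain l where "hnorm H (w \<ominus> rat_comb H f l) < \<epsilon> / 2"
    unfolding D_def by blast
  then show ?thesis
    using hnorm_triangle_minus[OF v w(2) rat_comb_closed[of f, OF f], of l] w(3)
    by (intro exI[of _ l]) simp
qed

text \<open>
  The right-hand side is \<open>\<parallel>v\<parallel>\<^sup>2 - \<parallel>v - q\<parallel>\<^sup>2\<close> for a rational combination \<open>q\<close>, so \<open>\<parallel>v\<parallel>\<^sup>2\<close> is a countable
  supremum of expressions in inner products with the \<open>f n\<close>.
\<close>

lemma hnorm_power2_greater_iff: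
  assumes tot: "total_in H (range f)" and v: "v \<in> carrier H"
  shows "a < (hnorm H v)\<^sup>2 \<longleftrightarrow>
    (\<exists>l. a < 2 * Re (cinner H (rat_comb H f l) v) - Re (cinner H (rat_comb H f l) (rat_comb H f l)))"
proof -
  have f: "f n \<in> carrier H" for n using tot by (auto simp: total_in_def)
  note cl = rat_comb_closed[of f, OF f]
  have eq: "2 * Re (cinner H (rat_comb H f l) v) - Re (cinner H (rat_comb H f l) (rat_comb H f l))
      = (hnorm H v)\<^sup>2 - (hnorm H (v \<ominus> rat_comb H f l))\<^sup>2" for l
    using v cl[of l] Re_cinner_commute[OF v cl[of l]]
    by (simp add: hnorm_minus_power2 hnorm_power2[OF cl])
  show ?thesis
  proof
    assume a: "a < (hnorm H v)\<^sup>2"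
    then have "0 < sqrt ((hnorm H v)\<^sup>2 - a)" by simp
    then obtain l where "hnorm H (v \<ominus> rat_comb H f l) < sqrt ((hnorm H v)\<^sup>2 - a)"
      using rat_comb_dense[OF tot v] by blast
    then have "(hnorm H (v \<ominus> rat_comb H f l))\<^sup>2 < (sqrt ((hnorm H v)\<^sup>2 - a))\<^sup>2"
      using v cl by (intro power_strict_mono) auto
    also have "\<dots> = (hnorm H v)\<^sup>2 - a" using a by simp
    finally show "\<exists>l. a < 2 * Re (cinner H (rat_comb H f l) v)
        - Re (cinner H (rat_comb H f l) (rat_comb H f l))"
      unfolding eq by (intro exI[of _ l]) simp
  next
    assume "\<exists>l. a < 2 * Re (cinner H (rat_comb H f l) v)
        - Re (cinner H (rat_comb H f l) (rat_comb H f l))"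
    then obtain l where "a < (hnorm H v)\<^sup>2 - (hnorm H (v \<ominus> rat_comb H f l))\<^sup>2"
      unfolding eq by blast
    then show "a < (hnorm H v)\<^sup>2"
      using zero_le_power2[of "hnorm H (v \<ominus> rat_comb H f l)"] by linarith
  qed
qed

end

section \<open>Products in a product system\<close>

text \<open>Expands \<langle>x - y, x - y\<rangle>. Unlike \<open>cinner_eqI\<close> it tests only
  against \<open>x\<close> and \<open>y\<close> themselves, which suits fibres
  \<open>E (s + t)\<close> where inner products are computed between products.\<close>

lemma (in inner_product_space) eqI_minus_null:
  assumes "x \<in> carrier H" "y \<in> carrier H"
    and "cinner H x x = cinner H y x" "cinner H x y = cinner H y y"
  shows "x = y"
proof -
  have "hnorm H (x \<ominus> y) = 0" using assms by (simp add: hnorm_def cinner_simps)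
  then show ?thesis using assms by simp
qed

context product_system
begin

lemma fibre [simp, intro]: "t > 0 \<Longrightarrow> inner_product_space (E t)"
  using fibre_hilbert hilbert_space.axioms(1) by blast

text \<open>The adjoint of a unitary is its inverse: the preimage of the elementary tensor satisfies
  the description in \<open>hadjoint\<close>, and nondegeneracy makes it the only such
  vector.\<close>

lemma sys_prod_preimage:
  assumes "s > 0" "t > 0" "x \<in> carrier (E s)" "y \<in> carrier (E t)"
  shows "sys_prod E B s t x y \<in> carrier (E (s + t))"
    and "B s t (sys_prod E B s t x y) = pure_tensor (E s) (E t) x y"
proof -
  interpret S: inner_product_space "E (s + t)" using assms by simp
  let ?T = "hilbert_tensor (E s) (E t)"
  have U: "B s t \<in> unitary_maps (E (s + t)) ?T" using structure_unitary assms by blast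
  have "pure_tensor (E s) (E t) x y \<in> carrier ?T" by (rule pure_tensor_carrier) fact+
  moreover have "B s t ` carrier (E (s + t)) = carrier ?T"
    using U unfolding unitary_maps_def bij_betw_def by blast
  ultimately obtain v where v: "v \<in> carrier (E (s + t))" "B s t v = pure_tensor (E s) (E t) x y"
    by (metis imageE)
  have "\<forall>v\<in>carrier (E (s + t)). \<forall>w\<in>carrier (E (s + t)).
      cinner ?T (B s t v) (B s t w) = cinner (E (s + t)) v w"
    using U unfolding unitary_maps_def by blast
  from bspec[OF this v(1)]
  have inner: "cinner (E (s + t)) v w = cinner ?T (pure_tensor (E s) (E t) x y) (B s t w)"
    if "w \<in> carrier (E (s + t))" for w
    using that v(2) by simp
  have "sys_prod E B s t x y = v"
    unfolding sys_prod_def hadjoint_def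
  proof (rule the_equality)
    show "v \<in> carrier (E (s + t)) \<and> (\<forall>w\<in>carrier (E (s + t)).
      cinner (E (s + t)) v w = cinner ?T (pure_tensor (E s) (E t) x y) (B s t w))"
      using v inner by blast
    show "v' = v" if "v' \<in> carrier (E (s + t)) \<and> (\<forall>w\<in>carrier (E (s + t)).
      cinner (E (s + t)) v' w = cinner ?T (pure_tensor (E s) (E t) x y) (B s t w))" for v'
      using that v(1) inner by (intro S.cinner_eqI) simp_all
  qed
  with v show "sys_prod E B s t x y \<in> carrier (E (s + t))"
    and "B s t (sys_prod E B s t x y) = pure_tensor (E s) (E t) x y" by auto
qed

lemmas sys_prod_closed [simp, intro] = sys_prod_preimage(1)

lemma cinner_sys_prod:
  assumes "s > 0" "t > 0" "x \<in> carrier (E s)" "y \<in> carrier (E t)"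
    "x' \<in> carrier (E s)" "y' \<in> carrier (E t)"
  shows "cinner (E (s + t)) (sys_prod E B s t x y) (sys_prod E B s t x' y')
    = cinner (E s) x x' * cinner (E t) y y'"
proof -
  have "cinner (E (s + t)) (sys_prod E B s t x y) (sys_prod E B s t x' y')
    = cinner (hilbert_tensor (E s) (E t)) (B s t (sys_prod E B s t x y)) (B s t (sys_prod E B s t x' y'))"
    using structure_unitary[OF assms(1,2)] assms unfolding unitary_maps_def by simp
  also have "\<dots> = cinner (E s) x x' * cinner (E t) y y'"
    using assms by (simp add: sys_prod_preimage(2) cinner_pure_tensor)
  finally show ?thesis .
qed

lemma hnorm_sys_prod:
  assumes "s > 0" "t > 0" "x \<in> carrier (E s)" "y \<in> carrier (E t)"
  shows "hnorm (E (s + t)) (sys_prod E B s t x y) = hnorm (E s) x * hnorm (E t) y"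
proof -
  interpret Es: inner_product_space "E s" using assms by simp
  interpret Et: inner_product_space "E t" using assms by simp
  have "Re (cinner (E (s + t)) (sys_prod E B s t x y) (sys_prod E B s t x y))
      = (hnorm (E s) x)\<^sup>2 * (hnorm (E t) y)\<^sup>2"
    using assms by (simp add: cinner_sys_prod Es.cinner_self Et.cinner_self
        flip: of_real_mult of_real_power)
  then have "hnorm (E (s + t)) (sys_prod E B s t x y) = sqrt ((hnorm (E s) x * hnorm (E t) y)\<^sup>2)"
    by (simp only: hnorm_def[of "E (s + t)"] power_mult_distrib)
  then show ?thesis using assms by simp
qed

text \<open>
  Linearity in each factor follows from the isometry property: the difference \<open>d\<close> of the two
  sides satisfies \<open>\<langle>d, d\<rangle> = 0\<close>.
\<close>

lemma sys_prod_linear: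
  assumes st: "s > 0" "t > 0"
  shows sys_prod_add_left: "\<lbrakk>x \<in> carrier (E s); x' \<in> carrier (E s); y \<in> carrier (E t)\<rbrakk> \<Longrightarrow>
      sys_prod E B s t (x \<oplus>\<^bsub>E s\<^esub> x') y
        = sys_prod E B s t x y \<oplus>\<^bsub>E (s + t)\<^esub> sys_prod E B s t x' y"
    and sys_prod_add_right: "\<lbrakk>x \<in> carrier (E s); y \<in> carrier (E t); y' \<in> carrier (E t)\<rbrakk> \<Longrightarrow>
      sys_prod E B s t x (y \<oplus>\<^bsub>E t\<^esub> y')
        = sys_prod E B s t x y \<oplus>\<^bsub>E (s + t)\<^esub> sys_prod E B s t x y'"
    and sys_prod_smult_left: "\<lbrakk>x \<in> carrier (E s); y \<in> carrier (E t)\<rbrakk> \<Longrightarrow>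
      sys_prod E B s t (c \<odot>\<^bsub>E s\<^esub> x) y = c \<odot>\<^bsub>E (s + t)\<^esub> sys_prod E B s t x y"
    and sys_prod_smult_right: "\<lbrakk>x \<in> carrier (E s); y \<in> carrier (E t)\<rbrakk> \<Longrightarrow>
      sys_prod E B s t x (c \<odot>\<^bsub>E t\<^esub> y) = c \<odot>\<^bsub>E (s + t)\<^esub> sys_prod E B s t x y"
proof -
  interpret Es: inner_product_space "E s" using st by simp
  interpret Et: inner_product_space "E t" using st by simp
  interpret S: inner_product_space "E (s + t)" using st by simp
  note simps = st cinner_sys_prod Es.cinner_simps Et.cinner_simps S.cinner_simps
  show "sys_prod E B s t (x \<oplus>\<^bsub>E s\<^esub> x') y
        = sys_prod E B s t x y \<oplus>\<^bsub>E (s + t)\<^esub> sys_prod E B s t x' y"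
    if "x \<in> carrier (E s)" "x' \<in> carrier (E s)" "y \<in> carrier (E t)"
    by (rule S.eqI_minus_null) (use that in \<open>simp_all add: simps algebra_simps\<close>)
  show "sys_prod E B s t x (y \<oplus>\<^bsub>E t\<^esub> y')
        = sys_prod E B s t x y \<oplus>\<^bsub>E (s + t)\<^esub> sys_prod E B s t x y'"
    if "x \<in> carrier (E s)" "y \<in> carrier (E t)" "y' \<in> carrier (E t)"
    by (rule S.eqI_minus_null) (use that in \<open>simp_all add: simps algebra_simps\<close>)
  show "sys_prod E B s t (c \<odot>\<^bsub>E s\<^esub> x) y = c \<odot>\<^bsub>E (s + t)\<^esub> sys_prod E B s t x y"
    if "x \<in> carrier (E s)" "y \<in> carrier (E t)"
    by (rule S.eqI_minus_null) (use that in \<open>simp_all add: simps algebra_simps\<close>)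
  show "sys_prod E B s t x (c \<odot>\<^bsub>E t\<^esub> y) = c \<odot>\<^bsub>E (s + t)\<^esub> sys_prod E B s t x y"
    if "x \<in> carrier (E s)" "y \<in> carrier (E t)"
    by (rule S.eqI_minus_null) (use that in \<open>simp_all add: simps algebra_simps\<close>)
qed

end

section \<open>Measurable sections\<close>

abbreviation pos_borel :: "real measure" where
  "pos_borel \<equiv> restrict_space borel {0<..}"

lemma measurable_pos_cong:
  assumes "g \<in> borel_measurable pos_borel" "\<And>t. t > 0 \<Longrightarrow> f t = g t"
  shows "f \<in> borel_measurable pos_borel"
  using assms(1) by (subst measurable_cong[of _ f g]) (auto simp: space_restrict_space assms(2))

lemma borel_measurable_complexI:
  assumes "(\<lambda>x. Re (f x)) \<in> borel_measurable M" "(\<lambda>x. Im (f x)) \<in> borel_measurable M"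
  shows "f \<in> borel_measurable M"
  using assms borel_measurable_complex_iff by blast

context arveson_system
begin

text \<open>
  Measurability of a section that need not be extensional; addition and scalar multiplication in
  the fibres do not preserve extensionality.
\<close>

definition measurable_section :: "(real \<Rightarrow> 'a) \<Rightarrow> bool" where
  "measurable_section x \<longleftrightarrow> (\<forall>t>0. x t \<in> carrier (E t)) \<and>
     (\<forall>n. (\<lambda>t. cinner (E t) (e n t) (x t)) \<in> borel_measurable pos_borel)"

lemma measurable_sections_iff:
  "x \<in> measurable_sections E e \<longleftrightarrow> x \<in> extensional {0<..} \<and> measurable_section x"
  by (auto simp: measurable_sections_def sections_def measurable_section_def PiE_iff)

lemma measurable_section_closed: "measurable_section x \<Longrightarrow> t > 0 \<Longrightarrow> x t \<in> carrier (E t)"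
  by (simp add: measurable_section_def)

lemma e_closed: "t > 0 \<Longrightarrow> e n t \<in> carrier (E t)"
  using e_section[of n] by (auto simp: sections_def)

lemma measurable_section_cong:
  assumes "measurable_section y" "\<And>t. t > 0 \<Longrightarrow> x t = y t"
  shows "measurable_section x"
  using assms unfolding measurable_section_def by (auto intro: measurable_pos_cong)

lemma measurable_section_e: "measurable_section (e n)"
  by (simp add: measurable_section_def e_closed e_measurable_inner)

lemma measurable_section_add:
  assumes "measurable_section x" "measurable_section y"
  shows "measurable_section (\<lambda>t. x t \<oplus>\<^bsub>E t\<^esub> y t)"
  unfolding measurable_section_def
proof (intro conjI allI impI)
  fix t :: real
  assume t: "t > 0"
  interpret inner_product_space "E t" using t by simp
  show "x t \<oplus>\<^bsub>E t\<^esub> y t \<in> carrier (E t)" using assms t by (simp add: measurable_section_def)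
next
  fix n
  have "(\<lambda>t. cinner (E t) (e n t) (x t) + cinner (E t) (e n t) (y t))
      \<in> borel_measurable pos_borel"
    using assms by (intro borel_measurable_add) (simp_all add: measurable_section_def)
  then show "(\<lambda>t. cinner (E t) (e n t) (x t \<oplus>\<^bsub>E t\<^esub> y t))
      \<in> borel_measurable pos_borel"
    by (rule measurable_pos_cong)
      (use assms in \<open>simp add: inner_product_space.cinner_add_right measurable_section_closed e_closed\<close>)
qed

lemma measurable_section_smult:
  assumes "measurable_section x" "c \<in> borel_measurable pos_borel"
  shows "measurable_section (\<lambda>t. c t \<odot>\<^bsub>E t\<^esub> x t)"
  unfolding measurable_section_def
proof (intro conjI allI impI)
  fix t :: real
  assume t: "t > 0"
  interpret inner_product_space "E t" using t by simp
  show "c t \<odot>\<^bsub>E t\<^esub> x t \<in> carrier (E t)" using assms t by (simp add: measurable_section_def)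
next
  fix n
  have "(\<lambda>t. c t * cinner (E t) (e n t) (x t)) \<in> borel_measurable pos_borel"
    using assms by (intro borel_measurable_times) (simp_all add: measurable_section_def)
  then show "(\<lambda>t. cinner (E t) (e n t) (c t \<odot>\<^bsub>E t\<^esub> x t))
      \<in> borel_measurable pos_borel"
    by (rule measurable_pos_cong)
      (use assms in \<open>simp add: inner_product_space.cinner_smult_right measurable_section_closed e_closed\<close>)
qed

lemma measurable_section_zero: "measurable_section (\<lambda>t. \<zero>\<^bsub>E t\<^esub>)"
  unfolding measurable_section_def
proof (intro conjI allI impI)
  show "\<zero>\<^bsub>E t\<^esub> \<in> carrier (E t)" if "t > 0" for t
  proof -
    interpret inner_product_space "E t" using that by simp
    show ?thesis by simp
  qed
  show "(\<lambda>t. cinner (E t) (e n t) \<zero>\<^bsub>E t\<^esub>) \<in> borel_measurable pos_borel" for n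
    by (rule measurable_pos_cong[of "\<lambda>_. 0"])
      (simp_all add: inner_product_space.cinner_zero_right e_closed)
qed

section \<open>Norms and inner products of measurable sections\<close>

lemma measurable_section_rat_comb: "measurable_section (\<lambda>t. rat_comb (E t) (\<lambda>n. e n t) l)"
  by (induction l) (auto intro!: measurable_section_zero measurable_section_add measurable_section_smult measurable_section_e)

lemma cinner_rat_comb_measurable:
  assumes "measurable_section x"
  shows "(\<lambda>t. cinner (E t) (rat_comb (E t) (\<lambda>n. e n t) l) (x t))
    \<in> borel_measurable pos_borel"
proof (induction l)
  case Nil
  show ?case
    by (rule measurable_pos_cong[of "\<lambda>_. 0"])
      (use assms in \<open>simp_all add: inner_product_space.cinner_zero_left measurable_section_closed\<close>)
next
  case (Cons p l)
  have "(\<lambda>t. cnj (rat_complex (snd p)) * cinner (E t) (e (fst p) t) (x t)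
      + cinner (E t) (rat_comb (E t) (\<lambda>n. e n t) l) (x t))
    \<in> borel_measurable pos_borel"
    using assms Cons by (intro borel_measurable_add borel_measurable_times) (simp_all add: measurable_section_def)
  then show ?case
  proof (rule measurable_pos_cong)
    fix t :: real
    assume t: "t > 0"
    interpret inner_product_space "E t" using t by simp
    show "cinner (E t) (rat_comb (E t) (\<lambda>n. e n t) (p # l)) (x t)
      = cnj (rat_complex (snd p)) * cinner (E t) (e (fst p) t) (x t)
        + cinner (E t) (rat_comb (E t) (\<lambda>n. e n t) l) (x t)"
      using t measurable_section_closed[OF assms t] measurable_section_closed[OF measurable_section_rat_comb[of l] t]
      by (simp add: cinner_add_left cinner_smult_left e_closed)
  qed
qed

text \<open>Each superlevel set is the union, over the countably many lists \<open>l\<close>, of the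
  superlevel sets of the measurable functions \<open>?g l\<close>.\<close>

lemma hnorm_power2_measurable:
  assumes "measurable_section x"
  shows "(\<lambda>t. (hnorm (E t) (x t))\<^sup>2) \<in> borel_measurable pos_borel"
  unfolding borel_measurable_iff_greater
proof
  fix a :: real
  let ?M = pos_borel
  let ?q = "\<lambda>l t. rat_comb (E t) (\<lambda>n. e n t) l"
  let ?g = "\<lambda>l t. 2 * Re (cinner (E t) (?q l t) (x t)) - Re (cinner (E t) (?q l t) (?q l t))"
  have meas: "?g l \<in> borel_measurable ?M" for l
  proof -
    note [measurable] = cinner_rat_comb_measurable[OF assms, of l]
      cinner_rat_comb_measurable[OF measurable_section_rat_comb, of l l]
    show ?thesis by measurable
  qed
  have "{t \<in> space ?M. a < ?g l t} \<in> sets ?M" for l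
    by (rule spec[OF iffD1[OF borel_measurable_iff_greater meas]])
  then have "(\<Union>l. {t \<in> space ?M. a < ?g l t}) \<in> sets ?M" by auto
  also have "(\<Union>l. {t \<in> space ?M. a < ?g l t}) = {t \<in> space ?M. a < (hnorm (E t) (x t))\<^sup>2}"
  proof -
    have "a < (hnorm (E t) (x t))\<^sup>2 \<longleftrightarrow> (\<exists>l. a < ?g l t)" if "t > 0" for t
      using that assms
      by (intro inner_product_space.hnorm_power2_greater_iff fibre e_total measurable_section_closed)
    then show ?thesis by (auto simp: space_restrict_space)
  qed
  finally show "{t \<in> space ?M. a < (hnorm (E t) (x t))\<^sup>2} \<in> sets ?M" .
qed

text \<open>Polarisation gives the real part from squared norms; the imaginary part is the real part
  after multiplying the second argument by -i.\<close>

lemma cinner_measurable: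
  assumes "measurable_section x" "measurable_section y"
  shows "(\<lambda>t. cinner (E t) (x t) (y t)) \<in> borel_measurable pos_borel"
proof -
  have Re: "(\<lambda>t. Re (cinner (E t) (x t) (z t))) \<in> borel_measurable pos_borel"
    if z: "measurable_section z" for z
  proof -
    have "(\<lambda>t. ((hnorm (E t) (x t \<oplus>\<^bsub>E t\<^esub> z t))\<^sup>2 - (hnorm (E t) (x t))\<^sup>2 - (hnorm (E t) (z t))\<^sup>2) / 2)
        \<in> borel_measurable pos_borel"
      by (intro borel_measurable_divide borel_measurable_diff hnorm_power2_measurable
          measurable_section_add assms z borel_measurable_const)
    then show ?thesis
      by (rule measurable_pos_cong)
        (use assms z in \<open>simp add: inner_product_space.hnorm_add_power2 measurable_section_closed\<close>)
  qed
  have "measurable_section (\<lambda>t. (- \<i>) \<odot>\<^bsub>E t\<^esub> y t)"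
    using assms by (intro measurable_section_smult borel_measurable_const)
  from Re[OF this] have "(\<lambda>t. Im (cinner (E t) (x t) (y t)))
      \<in> borel_measurable pos_borel"
    by (rule measurable_pos_cong)
      (use assms in \<open>simp add: inner_product_space.cinner_smult_right measurable_section_closed\<close>)
  with Re[OF assms(2)] show ?thesis by (rule borel_measurable_complexI)
qed

text \<open>By Cauchy-Schwarz, norm convergence in every fibre makes each function \<langle>e n,
  y\<rangle> a pointwise limit of measurable functions.\<close>

lemma measurable_section_limit:
  assumes x: "\<And>k. measurable_section (x k)" and y: "\<And>t. t > 0 \<Longrightarrow> y t \<in> carrier (E t)"
    and lim: "\<And>t. t > 0 \<Longrightarrow> (\<lambda>k. hnorm (E t) (x k t \<ominus>\<^bsub>E t\<^esub> y t)) \<longlonglongrightarrow> 0"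
  shows "measurable_section y"
  unfolding measurable_section_def
proof (intro conjI allI impI y)
  fix n
  show "(\<lambda>t. cinner (E t) (e n t) (y t)) \<in> borel_measurable pos_borel"
  proof (rule borel_measurable_LIMSEQ_metric)
    show "(\<lambda>t. cinner (E t) (e n t) (x k t)) \<in> borel_measurable pos_borel" for k
      using x by (simp add: measurable_section_def)
    fix t :: real
    assume "t \<in> space pos_borel"
    then have t: "t > 0" by (simp add: space_restrict_space)
    interpret inner_product_space "E t" using t by simp
    have "(\<lambda>k. hnorm (E t) (e n t) * hnorm (E t) (x k t \<ominus>\<^bsub>E t\<^esub> y t)) \<longlonglongrightarrow> 0"
      using tendsto_mult_right_zero[OF lim[OF t]] .
    then have "(\<lambda>k. cinner (E t) (e n t) (x k t) - cinner (E t) (e n t) (y t)) \<longlonglongrightarrow> 0"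
    proof (rule Lim_null_comparison[rotated], intro always_eventually allI)
      fix k
      have "cinner (E t) (e n t) (x k t) - cinner (E t) (e n t) (y t)
        = cinner (E t) (e n t) (x k t \<ominus>\<^bsub>E t\<^esub> y t)"
        using t x y by (simp add: cinner_minus_right e_closed measurable_section_closed)
      then show "norm (cinner (E t) (e n t) (x k t) - cinner (E t) (e n t) (y t))
        \<le> hnorm (E t) (e n t) * hnorm (E t) (x k t \<ominus>\<^bsub>E t\<^esub> y t)"
        using t x y Cauchy_Schwarz by (simp add: e_closed measurable_section_closed)
    qed
    then show "(\<lambda>k. cinner (E t) (e n t) (x k t)) \<longlonglongrightarrow> cinner (E t) (e n t) (y t)"
      by (rule LIM_zero_cancel)
  qed
qed

end

section \<open>Addits\<close>

context pointed_arveson_system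
begin

abbreviation A where "A \<equiv> addit_space E B e u"

lemma u_meas: "measurable_section u"
  using unit_measurable by (simp add: measurable_sections_iff)

lemma u_closed: "t > 0 \<Longrightarrow> u t \<in> carrier (E t)"
  using u_meas by (rule measurable_section_closed)

lemma u_inner: "t > 0 \<Longrightarrow> cinner (E t) (u t) (u t) = 1"
  by (simp add: inner_product_space.cinner_self u_closed unit_normalised)

lemma addits_iff:
  "a \<in> addits E B e u \<longleftrightarrow> a \<in> extensional {0<..} \<and> measurable_section a \<and>
    (\<forall>s>0. \<forall>t>0. a (s + t) =
       sys_prod E B s t (a s) (u t) \<oplus>\<^bsub>E (s + t)\<^esub> sys_prod E B s t (u s) (a t))"
  by (simp add: addits_def measurable_sections_iff)

lemma addit_meas: "a \<in> addits E B e u \<Longrightarrow> measurable_section a"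
  by (simp add: addits_iff)

lemma addit_closed: "\<lbrakk>a \<in> addits E B e u; t > 0\<rbrakk> \<Longrightarrow> a t \<in> carrier (E t)"
  by (simp add: addit_meas measurable_section_closed)

lemma addit_eq:
  "\<lbrakk>a \<in> addits E B e u; s > 0; t > 0\<rbrakk> \<Longrightarrow>
    a (s + t) = sys_prod E B s t (a s) (u t) \<oplus>\<^bsub>E (s + t)\<^esub> sys_prod E B s t (u s) (a t)"
  by (simp add: addits_iff)

lemma addit_ext:
  "\<lbrakk>a \<in> addits E B e u; b \<in> addits E B e u; \<And>t. t > 0 \<Longrightarrow> a t = b t\<rbrakk> \<Longrightarrow> a = b"
  by (rule extensionalityI[of _ "{0<..}"]) (auto simp: addits_iff)

text \<open>The addit equation evaluates \<open>a\<close> only at positive times, so it survives the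
  restriction that makes \<open>a\<close> extensional.\<close>

lemma additI:
  assumes "measurable_section a"
    and "\<And>s t. \<lbrakk>s > 0; t > 0\<rbrakk> \<Longrightarrow> a (s + t) =
       sys_prod E B s t (a s) (u t) \<oplus>\<^bsub>E (s + t)\<^esub> sys_prod E B s t (u s) (a t)"
  shows "(\<lambda>t\<in>{0<..}. a t) \<in> addits E B e u"
  unfolding addits_iff using assms by (auto intro: measurable_section_cong[OF assms(1)])

section \<open>The vector space of addits\<close>

lemma addit_add:
  assumes a: "a \<in> addits E B e u" and b: "b \<in> addits E B e u"
  shows "(\<lambda>t\<in>{0<..}. a t \<oplus>\<^bsub>E t\<^esub> b t) \<in> addits E B e u"
proof (rule additI)
  show "measurable_section (\<lambda>t. a t \<oplus>\<^bsub>E t\<^esub> b t)" using a b by (intro measurable_section_add addit_meas)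
  fix s t :: real
  assume st: "s > 0" "t > 0"
  interpret S: inner_product_space "E (s + t)" using st by simp
  note closed = st addit_closed[OF a st(1)] addit_closed[OF a st(2)]
    addit_closed[OF b st(1)] addit_closed[OF b st(2)] u_closed[OF st(1)] u_closed[OF st(2)]
  show "a (s + t) \<oplus>\<^bsub>E (s + t)\<^esub> b (s + t) =
      sys_prod E B s t (a s \<oplus>\<^bsub>E s\<^esub> b s) (u t) \<oplus>\<^bsub>E (s + t)\<^esub>
      sys_prod E B s t (u s) (a t \<oplus>\<^bsub>E t\<^esub> b t)"
    using closed
    by (intro S.cinner_eqI)
      (simp_all add: addit_eq[OF a] addit_eq[OF b] sys_prod_add_left sys_prod_add_right
        S.cinner_add_left)
qed

lemma addit_smult:
  assumes a: "a \<in> addits E B e u"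
  shows "(\<lambda>t\<in>{0<..}. c \<odot>\<^bsub>E t\<^esub> a t) \<in> addits E B e u"
proof (rule additI)
  show "measurable_section (\<lambda>t. c \<odot>\<^bsub>E t\<^esub> a t)" using a by (intro measurable_section_smult addit_meas) simp_all
  fix s t :: real
  assume st: "s > 0" "t > 0"
  interpret S: inner_product_space "E (s + t)" using st by simp
  note closed = st addit_closed[OF a st(1)] addit_closed[OF a st(2)]
    u_closed[OF st(1)] u_closed[OF st(2)]
  show "c \<odot>\<^bsub>E (s + t)\<^esub> a (s + t) =
      sys_prod E B s t (c \<odot>\<^bsub>E s\<^esub> a s) (u t) \<oplus>\<^bsub>E (s + t)\<^esub>
      sys_prod E B s t (u s) (c \<odot>\<^bsub>E t\<^esub> a t)"
    using closed
    by (simp add: addit_eq[OF a] sys_prod_smult_left sys_prod_smult_right S.smult_add_right)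
qed

lemma trivial_addit: "(\<lambda>t\<in>{0<..}. (c * of_real t) \<odot>\<^bsub>E t\<^esub> u t) \<in> addits E B e u"
proof (rule additI)
  have "(\<lambda>t. c * of_real t) \<in> borel_measurable pos_borel"
    by (intro measurable_restrict_space1) measurable
  then show "measurable_section (\<lambda>t. (c * of_real t) \<odot>\<^bsub>E t\<^esub> u t)" by (intro measurable_section_smult u_meas)
  fix s t :: real
  assume st: "s > 0" "t > 0"
  interpret S: inner_product_space "E (s + t)" using st by simp
  show "(c * of_real (s + t)) \<odot>\<^bsub>E (s + t)\<^esub> u (s + t) =
      sys_prod E B s t ((c * of_real s) \<odot>\<^bsub>E s\<^esub> u s) (u t) \<oplus>\<^bsub>E (s + t)\<^esub>
      sys_prod E B s t (u s) ((c * of_real t) \<odot>\<^bsub>E t\<^esub> u t)"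
    using st u_closed[OF st(1)] u_closed[OF st(2)]
    by (simp add: unit_mult sys_prod_smult_left sys_prod_smult_right distrib_left
        flip: S.smult_add_left)
qed

lemma zero_addit: "(\<lambda>t\<in>{0<..}. \<zero>\<^bsub>E t\<^esub>) \<in> addits E B e u"
proof (rule additI)
  show "measurable_section (\<lambda>t. \<zero>\<^bsub>E t\<^esub>)" by (rule measurable_section_zero)
  fix s t :: real
  assume st: "s > 0" "t > 0"
  interpret Es: inner_product_space "E s" using st by simp
  interpret Et: inner_product_space "E t" using st by simp
  interpret S: inner_product_space "E (s + t)" using st by simp
  have "sys_prod E B s t \<zero>\<^bsub>E s\<^esub> (u t) = \<zero>\<^bsub>E (s + t)\<^esub>"
    using sys_prod_smult_left[of s t "\<zero>\<^bsub>E s\<^esub>" "u t" 0] st u_closed[of t] by simp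
  moreover have "sys_prod E B s t (u s) \<zero>\<^bsub>E t\<^esub> = \<zero>\<^bsub>E (s + t)\<^esub>"
    using sys_prod_smult_right[of s t "u s" "\<zero>\<^bsub>E t\<^esub>" 0] st u_closed[of s] by simp
  ultimately show "\<zero>\<^bsub>E (s + t)\<^esub> = sys_prod E B s t \<zero>\<^bsub>E s\<^esub> (u t) \<oplus>\<^bsub>E (s + t)\<^esub>
      sys_prod E B s t (u s) \<zero>\<^bsub>E t\<^esub>" by simp
qed

lemma addit_space_simps [simp]:
  "carrier A = addits E B e u"
  "\<zero>\<^bsub>A\<^esub> = (\<lambda>t\<in>{0<..}. \<zero>\<^bsub>E t\<^esub>)"
  "a \<oplus>\<^bsub>A\<^esub> b = (\<lambda>t\<in>{0<..}. a t \<oplus>\<^bsub>E t\<^esub> b t)"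
  "c \<odot>\<^bsub>A\<^esub> a = (\<lambda>t\<in>{0<..}. c \<odot>\<^bsub>E t\<^esub> a t)"
  "cinner A a b = cinner (E 1) (a 1) (b 1)"
  by (simp_all add: addit_space_def)

lemma fibre_abelian_group: "t > 0 \<Longrightarrow> abelian_group (E t)"
  using module.axioms(2) inner_product_space.axioms(1) fibre by blast

lemma addit_space_module: "module Cring A"
proof (rule moduleI)
  show "cring Cring" by (rule cring_from_type_algebra)
  show "abelian_group A"
  proof (rule abelian_groupI)
    fix a b c assume abc: "a \<in> carrier A" "b \<in> carrier A" "c \<in> carrier A"
    show "(a \<oplus>\<^bsub>A\<^esub> b) \<oplus>\<^bsub>A\<^esub> c = a \<oplus>\<^bsub>A\<^esub> (b \<oplus>\<^bsub>A\<^esub> c)"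
      using abc by (auto simp: restrict_def fun_eq_iff abelian_monoid.a_assoc
          abelian_group.axioms(1) fibre_abelian_group addit_closed)
  next
    fix a b assume ab: "a \<in> carrier A" "b \<in> carrier A"
    then show "a \<oplus>\<^bsub>A\<^esub> b \<in> carrier A" by (simp add: addit_add)
    show "a \<oplus>\<^bsub>A\<^esub> b = b \<oplus>\<^bsub>A\<^esub> a"
      using ab abelian_monoid.a_comm[OF abelian_group.axioms(1)[OF fibre_abelian_group]]
      by (auto intro!: restrict_ext simp: addit_closed)
  next
    show "\<zero>\<^bsub>A\<^esub> \<in> carrier A" by (simp add: zero_addit)
  next
    fix a assume a: "a \<in> carrier A"
    show "\<zero>\<^bsub>A\<^esub> \<oplus>\<^bsub>A\<^esub> a = a"
    proof (rule addit_ext)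
      show "\<zero>\<^bsub>A\<^esub> \<oplus>\<^bsub>A\<^esub> a \<in> addits E B e u"
        using a addit_add[OF zero_addit, of a] by simp
      fix t :: real
      assume t: "t > 0"
      interpret inner_product_space "E t" using t by simp
      show "(\<zero>\<^bsub>A\<^esub> \<oplus>\<^bsub>A\<^esub> a) t = a t" using a t by (simp add: addit_closed)
    qed (use a in simp)
    show "\<exists>b\<in>carrier A. b \<oplus>\<^bsub>A\<^esub> a = \<zero>\<^bsub>A\<^esub>"
    proof (rule bexI)
      show "(- 1) \<odot>\<^bsub>A\<^esub> a \<in> carrier A" using a by (simp add: addit_smult)
      show "(- 1) \<odot>\<^bsub>A\<^esub> a \<oplus>\<^bsub>A\<^esub> a = \<zero>\<^bsub>A\<^esub>"
        unfolding addit_space_simps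
      proof (rule restrict_ext)
        fix t :: real
        assume t: "t \<in> {0<..}"
        interpret inner_product_space "E t" using t by simp
        have at: "a t \<in> carrier (E t)" using a t by (simp add: addit_closed)
        show "(\<lambda>t\<in>{0<..}. (- 1) \<odot>\<^bsub>E t\<^esub> a t) t \<oplus>\<^bsub>E t\<^esub> a t = \<zero>\<^bsub>E t\<^esub>"
          using t at by (simp flip: uminus_eq_smult add: M.l_neg)
      qed
    qed
  qed
next
  fix c d :: complex and a b
  assume a: "a \<in> carrier A"
  then show "c \<odot>\<^bsub>A\<^esub> a \<in> carrier A" by (simp add: addit_smult)
  show "(c \<oplus>\<^bsub>Cring\<^esub> d) \<odot>\<^bsub>A\<^esub> a = c \<odot>\<^bsub>A\<^esub> a \<oplus>\<^bsub>A\<^esub> d \<odot>\<^bsub>A\<^esub> a"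
    using a by (auto intro!: restrict_ext simp: addit_closed inner_product_space.smult_add_left)
  show "(c \<otimes>\<^bsub>Cring\<^esub> d) \<odot>\<^bsub>A\<^esub> a = c \<odot>\<^bsub>A\<^esub> (d \<odot>\<^bsub>A\<^esub> a)"
    using a by (auto intro!: restrict_ext simp: addit_closed inner_product_space.smult_smult)
  show "c \<odot>\<^bsub>A\<^esub> (a \<oplus>\<^bsub>A\<^esub> b) = c \<odot>\<^bsub>A\<^esub> a \<oplus>\<^bsub>A\<^esub> c \<odot>\<^bsub>A\<^esub> b" if "b \<in> carrier A"
    using a that
    by (auto intro!: restrict_ext simp: addit_closed inner_product_space.smult_add_right)
next
  fix a assume a: "a \<in> carrier A"
  show "\<one>\<^bsub>Cring\<^esub> \<odot>\<^bsub>A\<^esub> a = a"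
    by (rule addit_ext)
      (use a addit_smult[of a 1] in \<open>simp_all add: addit_closed inner_product_space.smult_1\<close>)
qed

section \<open>Splitting an addit into its trivial part and its root part\<close>

definition slope :: "(real \<Rightarrow> 'a) \<Rightarrow> complex" where
  "slope a = cinner (E 1) (u 1) (a 1)"

text \<open>Since \<open>u\<close> is multiplicative and normalised, the inner product of
  \<open>u (s + t)\<close> with \<open>a (s + t)\<close> factors into \<langle>u_s, a_s\<rangle> +
  \<langle>u_t, a_t\<rangle>. Linearity is then applied to the real and the imaginary part
  separately.\<close>

lemma cinner_unit_addit:
  assumes a: "a \<in> addits E B e u" and t: "t > 0"
  shows "cinner (E t) (u t) (a t) = slope a * of_real t"
proof -
  define f where "f t = cinner (E t) (u t) (a t)" for t
  have f_add: "f (s + t) = f s + f t" if st: "s > 0" "t > 0" for s t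
  proof -
    interpret S: inner_product_space "E (s + t)" using st by simp
    note closed = st addit_closed[OF a st(1)] addit_closed[OF a st(2)]
      u_closed[OF st(1)] u_closed[OF st(2)]
    show ?thesis
      using closed
      by (simp add: f_def addit_eq[OF a] unit_mult S.cinner_add_right cinner_sys_prod u_inner)
  qed
  have [measurable]: "f \<in> borel_measurable pos_borel"
    unfolding f_def by (intro cinner_measurable u_meas addit_meas a)
  have "Re (f t) = t * Re (f 1)"
    by (rule additive_measurable_imp_linear[of "\<lambda>t. Re (f t)"]) (use f_add t in auto)
  moreover have "Im (f t) = t * Im (f 1)"
    by (rule additive_measurable_imp_linear[of "\<lambda>t. Im (f t)"]) (use f_add t in auto)
  ultimately have "f t = f 1 * of_real t" by (simp add: complex_eq_iff)
  then show ?thesis by (simp add: f_def slope_def)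
qed

text \<open>Orthogonality to \<open>u\<close> at time 1 implies it at every time. Roots thus become
  the kernel of a linear functional on addits, the form in which they are used below.\<close>

lemma root_iff: "a \<in> roots E B e u \<longleftrightarrow> a \<in> addits E B e u \<and> slope a = 0"
proof
  assume "a \<in> roots E B e u"
  then show "a \<in> addits E B e u \<and> slope a = 0" by (simp add: roots_def slope_def)
next
  assume "a \<in> addits E B e u \<and> slope a = 0"
  then show "a \<in> roots E B e u" by (simp add: roots_def cinner_unit_addit)
qed

text \<open>For a root, \<open>a\<^sub>s \<cdot> u\<^sub>t\<close> and \<open>u\<^sub>s \<cdot> a\<^sub>t\<close> are orthogonal, so \<open>t \<mapsto> \<parallel>a\<^sub>t\<parallel>\<^sup>2\<close> is additive.\<close>

lemma hnorm_root:
  assumes r: "a \<in> roots E B e u" and t: "t > 0"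
  shows "(hnorm (E t) (a t))\<^sup>2 = t * (hnorm (E 1) (a 1))\<^sup>2"
proof (rule additive_measurable_imp_linear[OF _ _ t])
  have a: "a \<in> addits E B e u" using r by (simp add: roots_def)
  show "(\<lambda>t. (hnorm (E t) (a t))\<^sup>2) \<in> borel_measurable pos_borel"
    by (intro hnorm_power2_measurable addit_meas a)
  fix s t :: real
  assume st: "s > 0" "t > 0"
  interpret S: inner_product_space "E (s + t)" using st by simp
  note closed = st addit_closed[OF a st(1)] addit_closed[OF a st(2)]
    u_closed[OF st(1)] u_closed[OF st(2)]
  \<comment> \<open>The cross term \<langle>a_s \<cdot> u_t, u_s \<cdot> a_t\<rangle> factors as
    \<langle>a_s, u_s\<rangle> \<langle>u_t, a_t\<rangle>, and this is its second factor.\<close>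
  have "cinner (E t) (u t) (a t) = 0" using r st by (simp add: roots_def)
  then show "(hnorm (E (s + t)) (a (s + t)))\<^sup>2 = (hnorm (E s) (a s))\<^sup>2 + (hnorm (E t) (a t))\<^sup>2"
    using closed
    by (simp add: addit_eq[OF a] S.hnorm_add_power2 cinner_sys_prod hnorm_sys_prod unit_normalised)
qed

definition root_part :: "(real \<Rightarrow> 'a) \<Rightarrow> real \<Rightarrow> 'a" where
  "root_part a = (\<lambda>t\<in>{0<..}. a t \<ominus>\<^bsub>E t\<^esub> (slope a * of_real t) \<odot>\<^bsub>E t\<^esub> u t)"

lemma root_part_root:
  assumes a: "a \<in> addits E B e u"
  shows "root_part a \<in> roots E B e u"
proof -
  \<comment> \<open>The difference is written as a sum with the trivial addit of coefficient
    \<open>- slope a\<close>, so that closure of addits under addition applies.\<close>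
  have "(\<lambda>t\<in>{0<..}. a t \<oplus>\<^bsub>E t\<^esub> (\<lambda>t\<in>{0<..}. (- slope a * of_real t) \<odot>\<^bsub>E t\<^esub> u t) t) \<in> addits E B e u"
    by (intro addit_add a trivial_addit)
  also have "(\<lambda>t\<in>{0<..}. a t \<oplus>\<^bsub>E t\<^esub> (\<lambda>t\<in>{0<..}. (- slope a * of_real t) \<odot>\<^bsub>E t\<^esub> u t) t) = root_part a"
    unfolding root_part_def
  proof (rule restrict_ext)
    fix t :: real
    assume t: "t \<in> {0<..}"
    interpret inner_product_space "E t" using t by simp
    show "a t \<oplus>\<^bsub>E t\<^esub> (\<lambda>t\<in>{0<..}. (- slope a * of_real t) \<odot>\<^bsub>E t\<^esub> u t) t
        = a t \<ominus>\<^bsub>E t\<^esub> (slope a * of_real t) \<odot>\<^bsub>E t\<^esub> u t"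
      using t a by (simp add: minus_eq_smult smult_smult addit_closed u_closed)
  qed
  finally have addit: "root_part a \<in> addits E B e u" .
  interpret inner_product_space "E 1" by simp
  have "slope (root_part a) = 0"
    using addit_closed[OF a, of 1] u_closed[of 1] u_inner[of 1]
    by (simp add: slope_def root_part_def cinner_minus_right cinner_smult_right)
  with addit show ?thesis by (simp add: root_iff)
qed

lemma root_part_add:
  assumes a: "a \<in> addits E B e u" and t: "t > 0"
  shows "(slope a * of_real t) \<odot>\<^bsub>E t\<^esub> u t \<oplus>\<^bsub>E t\<^esub> root_part a t = a t"
proof -
  interpret inner_product_space "E t" using t by simp
  show ?thesis
    using t addit_closed[OF a t] u_closed[OF t]
    by (intro cinner_eqI) (simp_all add: root_part_def cinner_simps)
qed

lemma hnorm_addit: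
  assumes a: "a \<in> addits E B e u" and t: "t > 0"
  shows "(hnorm (E t) (a t))\<^sup>2 = (cmod (slope a))\<^sup>2 * t\<^sup>2 + t * (hnorm (E 1) (root_part a 1))\<^sup>2"
proof -
  interpret inner_product_space "E t" using t by simp
  have "root_part a \<in> addits E B e u" "slope (root_part a) = 0"
    using root_part_root[OF a] by (simp_all add: root_iff)
  then have r: "root_part a t \<in> carrier (E t)" "cinner (E t) (u t) (root_part a t) = 0"
    using t by (simp_all add: addit_closed cinner_unit_addit)
  have "(hnorm (E t) (a t))\<^sup>2
      = (hnorm (E t) ((slope a * of_real t) \<odot>\<^bsub>E t\<^esub> u t \<oplus>\<^bsub>E t\<^esub> root_part a t))\<^sup>2"
    by (simp only: root_part_add[OF a t])
  also have "\<dots> = (cmod (slope a) * t)\<^sup>2 + (hnorm (E t) (root_part a t))\<^sup>2"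
    using r t u_closed[OF t]
    by (simp add: hnorm_add_power2 cinner_smult_left hnorm_smult unit_normalised norm_mult)
  finally show ?thesis
    by (simp add: hnorm_root[OF root_part_root[OF a] t] power_mult_distrib)
qed

lemma hnorm_addit_le:
  assumes a: "a \<in> addits E B e u" and t: "t > 0"
  shows "hnorm (E t) (a t) \<le> sqrt (t\<^sup>2 + t) * hnorm (E 1) (a 1)"
proof (rule power2_le_imp_le)
  interpret E1: inner_product_space "E 1" by simp
  let ?c = "(cmod (slope a))\<^sup>2" and ?r = "(hnorm (E 1) (root_part a 1))\<^sup>2"
  have "(hnorm (E t) (a t))\<^sup>2 = ?c * t\<^sup>2 + t * ?r" by (rule hnorm_addit[OF a t])
  \<comment> \<open>A common factor dominating both \<open>t\<^sup>2\<close> and \<open>t\<close>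
    lets the bound be expressed through \<open>?c + ?r\<close>, which is the squared norm of
    \<open>a 1\<close>.\<close>
  also have "\<dots> \<le> ?c * (t\<^sup>2 + t) + (t\<^sup>2 + t) * ?r"
    using t by (intro add_mono mult_left_mono mult_right_mono) auto
  also have "\<dots> = (t\<^sup>2 + t) * (hnorm (E 1) (a 1))\<^sup>2"
    by (simp add: hnorm_addit[OF a, of 1] algebra_simps)
  also have "\<dots> = (sqrt (t\<^sup>2 + t) * hnorm (E 1) (a 1))\<^sup>2"
    using t by (simp add: power_mult_distrib)
  finally show "(hnorm (E t) (a t))\<^sup>2 \<le> (sqrt (t\<^sup>2 + t) * hnorm (E 1) (a 1))\<^sup>2" .
  show "0 \<le> sqrt (t\<^sup>2 + t) * hnorm (E 1) (a 1)"
    using t addit_closed[OF a, of 1] by simp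
qed

section \<open>The Hilbert space of addits\<close>

lemma addit_space_inner_product: "inner_product_space A"
proof (rule inner_product_space.intro[OF addit_space_module], unfold_locales)
  interpret E1: inner_product_space "E 1" by simp
  fix a b c z assume a: "a \<in> carrier A"
  show "cinner A a (b \<oplus>\<^bsub>A\<^esub> c) = cinner A a b + cinner A a c" if "b \<in> carrier A" "c \<in> carrier A"
    using a that by (simp add: E1.cinner_add_right addit_closed)
  show "cinner A a (z \<odot>\<^bsub>A\<^esub> b) = z * cinner A a b" if "b \<in> carrier A"
    using a that by (simp add: E1.cinner_smult_right addit_closed)
  show "cinner A b a = cnj (cinner A a b)" if "b \<in> carrier A"
    using a that E1.cinner_commute[of "a 1" "b 1"] by (simp add: addit_closed)
  show "Re (cinner A a a) > 0" if "a \<noteq> \<zero>\<^bsub>A\<^esub>"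
  proof -
    \<comment> \<open>Definiteness is the substantial axiom: an addit that vanishes at time 1
      vanishes at all times by \<open>hnorm_addit_le\<close>.\<close>
    have "a 1 \<noteq> \<zero>\<^bsub>E 1\<^esub>"
    proof
      assume 1: "a 1 = \<zero>\<^bsub>E 1\<^esub>"
      have "a t = \<zero>\<^bsub>E t\<^esub>" if t: "t > 0" for t
      proof -
        interpret inner_product_space "E t" using t by simp
        have "hnorm (E 1) (a 1) = 0" using 1 by simp
        then have "hnorm (E t) (a t) \<le> 0" using hnorm_addit_le[of a t] a t by simp
        moreover have at: "a t \<in> carrier (E t)" using a t by (simp add: addit_closed)
        ultimately have "hnorm (E t) (a t) = 0" using hnorm_nonneg[OF at] by linarith
        then show ?thesis using at by simp
      qed
      then have "a = \<zero>\<^bsub>A\<^esub>"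
        using a zero_addit by (intro addit_ext) simp_all
      with that show False by simp
    qed
    then show ?thesis using a E1.cinner_pos[of "a 1"] by (simp add: addit_closed)
  qed
qed

text \<open>The addit equation of \<open>\<sigma> k\<close> turns its distance from
  \<open>?v\<close> into the sum of two products, (\<sigma>_k - y)_s \<cdot> u_t and u_s \<cdot>
  (\<sigma>_k - y)_t. Norms of products multiply and \<open>u\<close> has norm 1, so the defect of
  \<open>y\<close> is at most a sum of three null sequences.\<close>

lemma addit_limit:
  assumes s: "\<And>k. \<sigma> k \<in> addits E B e u" and y: "\<And>t. t > 0 \<Longrightarrow> y t \<in> carrier (E t)"
    and lim: "\<And>t. t > 0 \<Longrightarrow> (\<lambda>k. hnorm (E t) (\<sigma> k t \<ominus>\<^bsub>E t\<^esub> y t)) \<longlonglongrightarrow> 0"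
  shows "(\<lambda>t\<in>{0<..}. y t) \<in> addits E B e u"
proof (rule additI)
  show "measurable_section y"
    by (rule measurable_section_limit[of \<sigma>]) (use s y lim addit_meas in auto)
  fix s t :: real
  assume st: "s > 0" "t > 0"
  interpret Es: inner_product_space "E s" using st by simp
  interpret Et: inner_product_space "E t" using st by simp
  interpret S: inner_product_space "E (s + t)" using st by simp
  note closed = st y[OF st(1)] y[OF st(2)] u_closed[OF st(1)] u_closed[OF st(2)]
  have ys: "y (s + t) \<in> carrier (E (s + t))" using y[of "s + t"] st by simp
  let ?v = "sys_prod E B s t (y s) (u t) \<oplus>\<^bsub>E (s + t)\<^esub> sys_prod E B s t (u s) (y t)"
  have v: "?v \<in> carrier (E (s + t))" using closed by simp
  have le: "hnorm (E (s + t)) (y (s + t) \<ominus>\<^bsub>E (s + t)\<^esub> ?v)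
      \<le> hnorm (E (s + t)) (\<sigma> k (s + t) \<ominus>\<^bsub>E (s + t)\<^esub> y (s + t))
        + (hnorm (E s) (\<sigma> k s \<ominus>\<^bsub>E s\<^esub> y s) + hnorm (E t) (\<sigma> k t \<ominus>\<^bsub>E t\<^esub> y t))" for k
  proof -
    note k = addit_closed[OF s[of k] st(1)] addit_closed[OF s[of k] st(2)]
    have kst: "\<sigma> k (s + t) \<in> carrier (E (s + t))" using addit_closed[OF s[of k]] st by simp
    let ?d = "sys_prod E B s t (\<sigma> k s \<ominus>\<^bsub>E s\<^esub> y s) (u t)"
    let ?d' = "sys_prod E B s t (u s) (\<sigma> k t \<ominus>\<^bsub>E t\<^esub> y t)"
    have "\<sigma> k (s + t) \<ominus>\<^bsub>E (s + t)\<^esub> ?v = ?d \<oplus>\<^bsub>E (s + t)\<^esub> ?d'"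
      using closed k
      by (intro S.cinner_eqI)
        (simp_all add: addit_eq[OF s] Es.minus_eq_smult Et.minus_eq_smult sys_prod_add_left
          sys_prod_add_right sys_prod_smult_left sys_prod_smult_right S.cinner_simps)
    then have "hnorm (E (s + t)) (\<sigma> k (s + t) \<ominus>\<^bsub>E (s + t)\<^esub> ?v)
        \<le> hnorm (E (s + t)) ?d + hnorm (E (s + t)) ?d'"
      using closed k S.hnorm_triangle[of ?d ?d'] by simp
    also have "\<dots> = hnorm (E s) (\<sigma> k s \<ominus>\<^bsub>E s\<^esub> y s) + hnorm (E t) (\<sigma> k t \<ominus>\<^bsub>E t\<^esub> y t)"
      using closed k by (simp add: hnorm_sys_prod unit_normalised)
    finally show ?thesis
      using S.hnorm_triangle_minus[OF ys kst v] S.hnorm_minus_commute[OF ys kst] by simp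
  qed
  have "(\<lambda>k. hnorm (E (s + t)) (\<sigma> k (s + t) \<ominus>\<^bsub>E (s + t)\<^esub> y (s + t))
        + (hnorm (E s) (\<sigma> k s \<ominus>\<^bsub>E s\<^esub> y s) + hnorm (E t) (\<sigma> k t \<ominus>\<^bsub>E t\<^esub> y t))) \<longlonglongrightarrow> 0 + (0 + 0)"
    using st by (intro tendsto_add lim) simp_all
  then have "hnorm (E (s + t)) (y (s + t) \<ominus>\<^bsub>E (s + t)\<^esub> ?v) \<le> 0 + (0 + 0)"
    by (rule LIMSEQ_le_const) (use le in blast)
  moreover have "0 \<le> hnorm (E (s + t)) (y (s + t) \<ominus>\<^bsub>E (s + t)\<^esub> ?v)"
    using ys v by simp
  ultimately have "hnorm (E (s + t)) (y (s + t) \<ominus>\<^bsub>E (s + t)\<^esub> ?v) = 0" by linarith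
  then show "y (s + t) = ?v" using ys v by simp
qed

lemma addit_space_minus:
  assumes "a \<in> addits E B e u" "b \<in> addits E B e u" "t > 0"
  shows "(a \<ominus>\<^bsub>A\<^esub> b) t = a t \<ominus>\<^bsub>E t\<^esub> b t"
proof -
  interpret A: inner_product_space A by (rule addit_space_inner_product)
  interpret inner_product_space "E t" using assms by simp
  show ?thesis using assms by (simp add: A.minus_eq_smult minus_eq_smult addit_closed)
qed

lemma hnorm_addit_space: "hnorm A a = hnorm (E 1) (a 1)"
  by (simp add: hnorm_def)

text \<open>Evaluation at \<open>t\<close> is bounded with constant
  \<open>sqrt (t\<^sup>2 + t)\<close>, so Cauchy sequences in \<open>A\<close> are Cauchy in every
  fibre. Nothing uniform in \<open>t\<close> is required of the pointwise limit: the distance in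
  \<open>A\<close> is the distance at time 1.\<close>

lemma addit_space_hilbert: "hilbert_space A"
proof (rule hilbert_space.intro[OF addit_space_inner_product], unfold_locales)
  interpret A: inner_product_space A by (rule addit_space_inner_product)
  interpret AM: Metric_space "carrier A" "hdist A" by (rule A.Metric_space_hdist)
  show "AM.mcomplete"
    unfolding AM.mcomplete_def
  proof (intro allI impI)
    fix \<sigma> assume cauchy: "AM.MCauchy \<sigma>"
    then have s: "\<sigma> k \<in> addits E B e u" for k
      unfolding AM.MCauchy_def by auto
    have "\<exists>y. y \<in> carrier (E t) \<and> (\<lambda>k. hnorm (E t) (\<sigma> k t \<ominus>\<^bsub>E t\<^esub> y)) \<longlonglongrightarrow> 0" if t: "t > 0" for t
    proof -
      interpret H: hilbert_space "E t" using t by (rule fibre_hilbert)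
      interpret M: Metric_space "carrier (E t)" "hdist (E t)" by (rule H.Metric_space_hdist)
      have st: "\<sigma> k t \<in> carrier (E t)" for k using addit_closed[OF s t] .
      have "M.MCauchy (\<lambda>k. \<sigma> k t)"
        unfolding M.MCauchy_def
      proof (intro conjI allI impI)
        show "range (\<lambda>k. \<sigma> k t) \<subseteq> carrier (E t)" using st by auto
        fix \<epsilon> :: real assume e: "\<epsilon> > 0"
        have pos: "sqrt (t\<^sup>2 + t) > 0" using t by (simp add: add_pos_pos)
        then have "\<epsilon> / sqrt (t\<^sup>2 + t) > 0" using e by simp
        then obtain N where N: "\<And>n n'. N \<le> n \<Longrightarrow> N \<le> n' \<Longrightarrow> hdist A (\<sigma> n) (\<sigma> n') < \<epsilon> / sqrt (t\<^sup>2 + t)"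
          using cauchy unfolding AM.MCauchy_def by blast
        have "hdist (E t) (\<sigma> n t) (\<sigma> n' t) < \<epsilon>" if "N \<le> n" "N \<le> n'" for n n'
        proof -
          \<comment> \<open>The estimate between times 1 and \<open>t\<close> is for a single addit,
            so it is applied to the difference.\<close>
          have d: "\<sigma> n \<ominus>\<^bsub>A\<^esub> \<sigma> n' \<in> addits E B e u"
            using A.minus_in_carrier[of "\<sigma> n" "\<sigma> n'"] s by simp
          have "hdist (E t) (\<sigma> n t) (\<sigma> n' t) = hnorm (E t) ((\<sigma> n \<ominus>\<^bsub>A\<^esub> \<sigma> n') t)"
            using s st t by (simp add: addit_space_minus)
          also have "\<dots> \<le> sqrt (t\<^sup>2 + t) * hdist A (\<sigma> n) (\<sigma> n')"
            using hnorm_addit_le[OF d t] s by (simp add: hnorm_addit_space)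
          also have "\<dots> < sqrt (t\<^sup>2 + t) * (\<epsilon> / sqrt (t\<^sup>2 + t))"
            using N[OF that] pos by (intro mult_strict_left_mono)
          also have "\<dots> = \<epsilon>" using pos by (metis less_irrefl mult.commute nonzero_eq_divide_eq)
          finally show ?thesis .
        qed
        then show "\<exists>N. \<forall>n n'. N \<le> n \<longrightarrow> N \<le> n' \<longrightarrow> hdist (E t) (\<sigma> n t) (\<sigma> n' t) < \<epsilon>" by blast
      qed
      then obtain y where "limitin M.mtopology (\<lambda>k. \<sigma> k t) y sequentially"
        using H.complete unfolding M.mcomplete_def by blast
      then have y: "y \<in> carrier (E t)" "(\<lambda>k. hdist (E t) (\<sigma> k t) y) \<longlonglongrightarrow> 0"
        by (simp_all add: M.limitin_metric_dist_null)
      then show ?thesis using st by (intro exI[of _ y]) simp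
    qed
    then obtain y where y: "\<And>t. t > 0 \<Longrightarrow> y t \<in> carrier (E t)"
      and lim: "\<And>t. t > 0 \<Longrightarrow> (\<lambda>k. hnorm (E t) (\<sigma> k t \<ominus>\<^bsub>E t\<^esub> y t)) \<longlonglongrightarrow> 0"
      by metis
    let ?y = "\<lambda>t\<in>{0<..}. y t"
    have ya: "?y \<in> addits E B e u" by (rule addit_limit[OF s y lim])
    have "hdist A (\<sigma> k) ?y = hnorm (E 1) (\<sigma> k 1 \<ominus>\<^bsub>E 1\<^esub> y 1)" for k
      using s ya by (simp add: hnorm_addit_space addit_space_minus)
    then have "(\<lambda>k. hdist A (\<sigma> k) ?y) \<longlonglongrightarrow> 0" using lim[of 1] by simp
    then have "limitin AM.mtopology \<sigma> ?y sequentially"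
      unfolding AM.limitin_metric_dist_null using s ya by simp
    then show "\<exists>x. limitin AM.mtopology \<sigma> x sequentially" by blast
  qed
qed

section \<open>The orthogonal decomposition\<close>

lemma trivial_addits_submodule: "submodule (trivial_addits E u) Cring A"
proof -
  interpret A: inner_product_space A by (rule addit_space_inner_product)
  have add: "(\<lambda>t\<in>{0<..}. (c * of_real t) \<odot>\<^bsub>E t\<^esub> u t) \<oplus>\<^bsub>A\<^esub> (\<lambda>t\<in>{0<..}. (d * of_real t) \<odot>\<^bsub>E t\<^esub> u t)
      = (\<lambda>t\<in>{0<..}. ((c + d) * of_real t) \<odot>\<^bsub>E t\<^esub> u t)" for c d
    by (auto intro!: restrict_ext
        simp: distrib_right inner_product_space.smult_add_left u_closed)
  have smult: "d \<odot>\<^bsub>A\<^esub> (\<lambda>t\<in>{0<..}. (c * of_real t) \<odot>\<^bsub>E t\<^esub> u t)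
      = (\<lambda>t\<in>{0<..}. ((d * c) * of_real t) \<odot>\<^bsub>E t\<^esub> u t)" for c d
    by (auto intro!: restrict_ext
        simp: inner_product_space.smult_smult u_closed mult.assoc)
  have sub: "trivial_addits E u \<subseteq> carrier A"
    using trivial_addit by (auto simp: trivial_addits_def)
  have tr: "(\<lambda>t\<in>{0<..}. (c * of_real t) \<odot>\<^bsub>E t\<^esub> u t) \<in> trivial_addits E u" for c
    by (auto simp: trivial_addits_def)
  have trE: "\<exists>c. a = (\<lambda>t\<in>{0<..}. (c * of_real t) \<odot>\<^bsub>E t\<^esub> u t)" if "a \<in> trivial_addits E u" for a
    using that by (simp add: trivial_addits_def)
  have sm: "d \<odot>\<^bsub>A\<^esub> a \<in> trivial_addits E u" if a: "a \<in> trivial_addits E u" for a d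
  proof -
    obtain c where "a = (\<lambda>t\<in>{0<..}. (c * of_real t) \<odot>\<^bsub>E t\<^esub> u t)"
      using trE[OF a] by blast
    then show ?thesis by (simp only: smult tr)
  qed
  show ?thesis
  proof (rule A.submoduleI)
    have "\<zero>\<^bsub>A\<^esub> = 0 \<odot>\<^bsub>A\<^esub> (\<lambda>t\<in>{0<..}. (0 * of_real t) \<odot>\<^bsub>E t\<^esub> u t)"
      using A.smult_0[of "\<lambda>t\<in>{0<..}. (0 * of_real t) \<odot>\<^bsub>E t\<^esub> u t"] trivial_addit[of 0] by simp
    also have "\<dots> \<in> trivial_addits E u" by (rule sm[OF tr])
    finally show "\<zero>\<^bsub>A\<^esub> \<in> trivial_addits E u" .
    show "\<ominus>\<^bsub>A\<^esub> a \<in> trivial_addits E u" if "a \<in> trivial_addits E u" for a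
    proof -
      have "\<ominus>\<^bsub>A\<^esub> a = (- 1) \<odot>\<^bsub>A\<^esub> a" by (rule A.uminus_eq_smult) (use sub that in blast)
      then show ?thesis using sm[OF that, of "- 1"] by (simp only:)
    qed
    show "a \<oplus>\<^bsub>A\<^esub> b \<in> trivial_addits E u" if ab: "a \<in> trivial_addits E u" "b \<in> trivial_addits E u" for a b
    proof -
      obtain c d where "a = (\<lambda>t\<in>{0<..}. (c * of_real t) \<odot>\<^bsub>E t\<^esub> u t)"
        "b = (\<lambda>t\<in>{0<..}. (d * of_real t) \<odot>\<^bsub>E t\<^esub> u t)"
        using trE[OF ab(1)] trE[OF ab(2)] by blast
      then show ?thesis by (simp only: add tr)
    qed
    show "d \<odot>\<^bsub>A\<^esub> a \<in> trivial_addits E u" if "a \<in> trivial_addits E u" for a d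
      by (rule sm[OF that])
  qed (rule sub)
qed

lemma roots_submodule: "submodule (roots E B e u) Cring A"
proof -
  interpret A: inner_product_space A by (rule addit_space_inner_product)
  interpret E1: inner_product_space "E 1" by simp
  have sm: "d \<odot>\<^bsub>A\<^esub> a \<in> roots E B e u" if "a \<in> roots E B e u" for a d
    using that
    by (simp add: root_iff addit_smult slope_def E1.cinner_smult_right u_closed addit_closed)
  show ?thesis
  proof (rule A.submoduleI)
    show "roots E B e u \<subseteq> carrier A" by (auto simp: root_iff)
    show "\<zero>\<^bsub>A\<^esub> \<in> roots E B e u" by (simp add: root_iff zero_addit slope_def u_closed)
    show "\<ominus>\<^bsub>A\<^esub> a \<in> roots E B e u" if "a \<in> roots E B e u" for a
    proof -
      have "\<ominus>\<^bsub>A\<^esub> a = (- 1) \<odot>\<^bsub>A\<^esub> a" by (rule A.uminus_eq_smult) (use that in \<open>simp add: root_iff\<close>)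
      then show ?thesis using sm[OF that, of "- 1"] by (simp only:)
    qed
    show "a \<oplus>\<^bsub>A\<^esub> b \<in> roots E B e u" if "a \<in> roots E B e u" "b \<in> roots E B e u" for a b
      using that
      by (simp add: root_iff addit_add slope_def E1.cinner_add_right u_closed addit_closed)
  qed (rule sm)
qed

lemma trivial_root_orthogonal:
  assumes "a \<in> trivial_addits E u" "b \<in> roots E B e u"
  shows "cinner A a b = 0"
proof -
  interpret E1: inner_product_space "E 1" by simp
  obtain c where a: "a = (\<lambda>t\<in>{0<..}. (c * of_real t) \<odot>\<^bsub>E t\<^esub> u t)"
    using assms(1) by (auto simp: trivial_addits_def)
  have "cinner (E 1) (u 1) (b 1) = 0" "b 1 \<in> carrier (E 1)"
    using assms(2) by (simp_all add: root_iff slope_def addit_closed)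
  then show ?thesis by (simp add: a E1.cinner_smult_left u_closed)
qed

lemma trivial_add_roots: "trivial_addits E u <+>\<^bsub>A\<^esub> roots E B e u = addits E B e u"
proof (intro equalityI subsetI)
  fix x assume "x \<in> trivial_addits E u <+>\<^bsub>A\<^esub> roots E B e u"
  then obtain a b where "a \<in> trivial_addits E u" "b \<in> roots E B e u" "x = a \<oplus>\<^bsub>A\<^esub> b"
    unfolding set_add_def' by blast
  then show "x \<in> addits E B e u"
    using trivial_addit by (auto simp: trivial_addits_def root_iff intro!: addit_add)
next
  fix a assume a: "a \<in> addits E B e u"
  let ?t = "\<lambda>t\<in>{0<..}. (slope a * of_real t) \<odot>\<^bsub>E t\<^esub> u t"
  have r: "root_part a \<in> roots E B e u" by (rule root_part_root[OF a])
  have "a = ?t \<oplus>\<^bsub>A\<^esub> root_part a"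
  proof (rule addit_ext[OF a])
    show "?t \<oplus>\<^bsub>A\<^esub> root_part a \<in> addits E B e u"
      unfolding addit_space_simps
      by (rule addit_add[OF trivial_addit]) (use r in \<open>simp add: root_iff\<close>)
    show "a t = (?t \<oplus>\<^bsub>A\<^esub> root_part a) t" if "t > 0" for t
      using that root_part_add[OF a that] by simp
  qed
  moreover have "?t \<in> trivial_addits E u" by (auto simp: trivial_addits_def)
  ultimately show "a \<in> trivial_addits E u <+>\<^bsub>A\<^esub> roots E B e u"
    using r unfolding set_add_def' by blast
qed

text \<open>An addit lying in both subspaces is orthogonal to itself.\<close>

lemma trivial_inter_roots: "trivial_addits E u \<inter> roots E B e u = {\<zero>\<^bsub>A\<^esub>}"
proof -
  interpret A: inner_product_space A by (rule addit_space_inner_product)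
  have "a = \<zero>\<^bsub>A\<^esub>" if "a \<in> trivial_addits E u" "a \<in> roots E B e u" for a
    using A.cinner_pos[of a] trivial_root_orthogonal[OF that] that(2)
    by (auto simp: root_iff simp del: addit_space_simps(2,5))
  moreover have "\<zero>\<^bsub>A\<^esub> \<in> trivial_addits E u" "\<zero>\<^bsub>A\<^esub> \<in> roots E B e u"
    using subgroup.one_closed[OF submodule.axioms(1)[OF trivial_addits_submodule]]
      subgroup.one_closed[OF submodule.axioms(1)[OF roots_submodule]] by auto
  ultimately show ?thesis by blast
qed

end

theorem proposition3p2:
  fixes E :: "real \<Rightarrow> 'a hilb"
    and B :: "real \<Rightarrow> real \<Rightarrow> 'a \<Rightarrow> (nat \<Rightarrow> 'a \<times> 'a \<Rightarrow>\<^sub>0 complex) set"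
    and e :: "nat \<Rightarrow> real \<Rightarrow> 'a" and u :: "real \<Rightarrow> 'a"
  assumes "pointed_arveson_system E B e u"
  shows "hilbert_space (addit_space E B e u)
    \<and> submodule (trivial_addits E u) Cring (addit_space E B e u)
    \<and> submodule (roots E B e u) Cring (addit_space E B e u)
    \<and> trivial_addits E u <+>\<^bsub>addit_space E B e u\<^esub> roots E B e u = addits E B e u
    \<and> trivial_addits E u \<inter> roots E B e u = {\<zero>\<^bsub>addit_space E B e u\<^esub>}
    \<and> (\<forall>a\<in>trivial_addits E u. \<forall>b\<in>roots E B e u. cinner (addit_space E B e u) a b = 0)"
proof -
  interpret pointed_arveson_system E B e u by fact
  show ?thesis
    by (intro conjI ballI addit_space_hilbert trivial_addits_submodule roots_submodule
        trivial_add_roots trivial_inter_roots trivial_root_orthogonal)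
qed

end
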